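(* Let $p\geqslant1$, $\mu,\nu\in P_p(\mathbb{R}^d)$, and let $c(x,y)=h(x-y)$ be a cost satisfying the standing assumption (see context) with this $p$. Then: (i) The backward dual $D_c(\mu,P_{\leqslant\nu})$ is attained in the class $\mathcal{A}\cap L^1(d\nu)$. (ii) The forward dual $D_c(P_{\mu\leqslant},\nu)$ is attained in the class $\mathcal{A}\cap C_{b,p}$. (iii) Let $m_\nu=\int y\,d\nu$. If $\varphi$ is an optimizer for $D_c(\mu,P_{\leqslant\nu})$ with $\varphi(m_\nu)=0$, then an optimizer $\psi$ for $D_c(P_{\mu\leqslant},\nu)$ may be chosen so that $\psi=Q_c(\varphi)$ and $\psi$ satisfies the pointwise bound $$-\kappa|x|-\alpha\leqslant\psi(x)\leqslant h(x-m_\nu)\qquad\text{for all }x\in\mathbb{R}^d,$$ where $\kappa,\alpha>0$ are constants depending only on $m_\nu$, the cost $c$ and the bounds of the dual (i.e. bounds on the dual values).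
   Context: $P_p(\mathbb{R}^d)$ is the set of Borel probability measures on $\mathbb{R}^d$ with finite $p$-th moment. $\mathcal{A}$ is the set of real-valued convex functions on $\mathbb{R}^d$. $C_{b,p}$ is the set of continuous $f:\mathbb{R}^d\to\mathbb{R}$ such that $f(x)/(1+|x|^p)$ is bounded. Convex order: $\mu\leqslant_{cx}\nu$ iff $\int\varphi\,d\mu\leqslant\int\varphi\,d\nu$ for all $\varphi\in\mathcal{A}$. $P_{\leqslant\nu}=\{\eta\in P_1(\mathbb{R}^d):\eta\leqslant_{cx}\nu\}$, $P_{\mu\leqslant}=\{\xi\in P_1(\mathbb{R}^d):\mu\leqslant_{cx}\xi\}$. Standing assumption on the cost: $c(x,y)=h(x-y)$ with $h:\mathbb{R}^d\to[0,\infty)$ strictly convex such that for some $a>0$, $\inf_{|z|\geqslant a}h(z)/|z|>0$ and $\sup_{|z|\geqslant a}h(z)/|z|^p<\infty$. Transforms: $Q_c(\varphi)(x)=\inf_{y}\{\varphi(y)+c(x,y)\}$, $Q_{\bar c}(\psi)(y)=\sup_{x}\{\psi(x)-c(x,y)\}$. Dual problems: $D_c(\mu,P_{\leqslant\nu})=\sup_{\varphi\in\mathcal{A}\cap C_{b,p}}\{\int Q_c(\varphi)d\mu-\int\varphi\,d\nu\}$ (backward; the class may be relaxed to $\mathcal{A}\cap L^1(d\nu)$ without changing the supremum) and $D_c(P_{\mu\leqslant},\nu)=\sup_{\psi\in\mathcal{A}\cap C_{b,p}}\{\int\psi\,d\mu-\int Q_{\bar c}(\psi)d\nu\}$ (forward).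 The dual is attained in a class if some function of that class (an optimizer) makes the corresponding functional equal to the supremum.
   Formalization: In (i) (and for φ in (iii)) convex functions in L^1(dν) may take the value +∞ on a ν-null set, since a real-valued optimizer can fail to exist; in (iii) the "bounds of the dual" mean an upper bound of ∫c(x,m_ν)dμ, as bounds on the dual value alone do not suffice. *)

theory Defs
  imports "HOL-Probability.Probability"
begin

definition P_space :: "real \<Rightarrow> 'a::euclidean_space measure set" where
  "P_space p = {M. prob_space M \<and> sets M = sets borel \<and> integrable M (\<lambda>x. norm x powr p)}"

definition C_bp :: "real \<Rightarrow> ('a::euclidean_space \<Rightarrow> real) set" where
  "C_bp p = {f. continuous_on UNIV f \<and> bounded (range (\<lambda>x. f x / (1 + norm x powr p)))}"

definition convex_class :: "('a::euclidean_space \<Rightarrow> real) set" where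
  "convex_class = {f. convex_on UNIV f}"

text \<open>
  The convex functions in L1(nu), as functions with values in \<open>(-\<infinity>, \<infinity>]\<close>. Integrability makes
  them finite nu-almost everywhere. The value \<open>\<infinity>\<close> cannot be excluded off a null set: on the real
  line with cost \<open>(x - y)^2\<close>, nu the Dirac measure at 0 and mu a standard Gaussian, the supremum
  of the backward dual is the second moment of mu, and an optimizer must satisfy
  \<open>\<phi> y - \<phi> 0 \<ge> 2 * x * y - y^2\<close> for mu-almost every x, hence be infinite off 0. Real-valued convex
  functions in L1(nu) are members through the embedding \<open>ereal\<close>.
\<close>

definition convex_L1 :: "'a::euclidean_space measure \<Rightarrow> ('a \<Rightarrow> ereal) set" where
  "convex_L1 \<nu> = {\<phi>.
     (\<forall>x. \<phi> x \<noteq> -\<infinity>) \<and>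
     (\<forall>x y. \<forall>t\<in>{0<..<1::real}.
        \<phi> ((1 - t) *\<^sub>R x + t *\<^sub>R y) \<le> ereal (1 - t) * \<phi> x + ereal t * \<phi> y) \<and>
     \<phi> \<in> borel_measurable \<nu> \<and> (\<integral>\<^sup>+x. e2ennreal \<bar>\<phi> x\<bar> \<partial>\<nu>) < \<infinity>}"

definition strictly_convex :: "('a::euclidean_space \<Rightarrow> real) \<Rightarrow> bool" where
  "strictly_convex h \<longleftrightarrow>
     (\<forall>x y. x \<noteq> y \<longrightarrow> (\<forall>t\<in>{0<..<1::real}.
        h ((1 - t) *\<^sub>R x + t *\<^sub>R y) < (1 - t) * h x + t * h y))"

definition admissible :: "real \<Rightarrow> ('a::euclidean_space \<Rightarrow> real) \<Rightarrow> bool" where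
  "admissible p h \<longleftrightarrow>
     (\<forall>z. 0 \<le> h z) \<and> strictly_convex h \<and>
     (\<exists>a>0. 0 < (INF z\<in>{z. a \<le> norm z}. ereal (h z / norm z)) \<and>
            (SUP z\<in>{z. a \<le> norm z}. ereal (h z / norm z powr p)) < \<infinity>)"

definition cost :: "('a::euclidean_space \<Rightarrow> real) \<Rightarrow> 'a \<Rightarrow> 'a \<Rightarrow> real" where
  "cost h x y = h (x - y)"

text \<open>
  The transforms are extended-real valued, since the infimum may be \<open>-\<infinity>\<close> and the supremum \<open>\<infinity>\<close>.
\<close>

definition Q_c :: "('a \<Rightarrow> 'a \<Rightarrow> real) \<Rightarrow> ('a \<Rightarrow> ereal) \<Rightarrow> 'a \<Rightarrow> ereal" where
  "Q_c c \<phi> x = (INF y. \<phi> y + ereal (c x y))"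

definition Q_cbar :: "('a \<Rightarrow> 'a \<Rightarrow> real) \<Rightarrow> ('a \<Rightarrow> ereal) \<Rightarrow> 'a \<Rightarrow> ereal" where
  "Q_cbar c \<psi> y = (SUP x. \<psi> x - ereal (c x y))"

text \<open>
  Integral of an extended-real function as the integral of the positive part minus that of the
  negative part (\<open>e2ennreal\<close> truncates negative values to 0). Below, no difference \<open>\<infinity> - \<infinity>\<close>
  arises: \<open>Q_c c \<phi>\<close> is bounded above by, and \<open>Q_cbar c \<psi>\<close> bounded below by, a function in
  \<open>C_bp p\<close>, so the functionals take values in \<open>[-\<infinity>, \<infinity>)\<close>.
\<close>

definition ext_integral :: "'a measure \<Rightarrow> ('a \<Rightarrow> ereal) \<Rightarrow> ereal" where
  "ext_integral M f =
     enn2ereal (\<integral>\<^sup>+x. e2ennreal (f x) \<partial>M) - enn2ereal (\<integral>\<^sup>+x. e2ennreal (- f x) \<partial>M)"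

definition backward_functional ::
  "('a \<Rightarrow> 'a \<Rightarrow> real) \<Rightarrow> 'a measure \<Rightarrow> 'a measure \<Rightarrow> ('a \<Rightarrow> ereal) \<Rightarrow> ereal" where
  "backward_functional c \<mu> \<nu> \<phi> = ext_integral \<mu> (Q_c c \<phi>) - ext_integral \<nu> \<phi>"

definition forward_functional ::
  "('a \<Rightarrow> 'a \<Rightarrow> real) \<Rightarrow> 'a measure \<Rightarrow> 'a measure \<Rightarrow> ('a \<Rightarrow> ereal) \<Rightarrow> ereal" where
  "forward_functional c \<mu> \<nu> \<psi> = ext_integral \<mu> \<psi> - ext_integral \<nu> (Q_cbar c \<psi>)"

definition backward_dual ::
  "real \<Rightarrow> ('a \<Rightarrow> 'a \<Rightarrow> real) \<Rightarrow> 'a::euclidean_space measure \<Rightarrow> 'a measure \<Rightarrow> ereal" where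
  "backward_dual p c \<mu> \<nu> =
     (SUP f\<in>convex_class \<inter> C_bp p. backward_functional c \<mu> \<nu> (\<lambda>x. ereal (f x)))"

definition forward_dual ::
  "real \<Rightarrow> ('a \<Rightarrow> 'a \<Rightarrow> real) \<Rightarrow> 'a::euclidean_space measure \<Rightarrow> 'a measure \<Rightarrow> ereal" where
  "forward_dual p c \<mu> \<nu> =
     (SUP f\<in>convex_class \<inter> C_bp p. forward_functional c \<mu> \<nu> (\<lambda>x. ereal (f x)))"

definition backward_optimizer ::
  "real \<Rightarrow> ('a \<Rightarrow> 'a \<Rightarrow> real) \<Rightarrow> 'a::euclidean_space measure \<Rightarrow> 'a measure \<Rightarrow> ('a \<Rightarrow> ereal) \<Rightarrow> bool"
  where
  "backward_optimizer p c \<mu> \<nu> \<phi> \<longleftrightarrow>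
     \<phi> \<in> convex_L1 \<nu> \<and> backward_functional c \<mu> \<nu> \<phi> = backward_dual p c \<mu> \<nu>"

definition forward_optimizer ::
  "real \<Rightarrow> ('a \<Rightarrow> 'a \<Rightarrow> real) \<Rightarrow> 'a::euclidean_space measure \<Rightarrow> 'a measure \<Rightarrow> ('a \<Rightarrow> real) \<Rightarrow> bool"
  where
  "forward_optimizer p c \<mu> \<nu> \<psi> \<longleftrightarrow>
     \<psi> \<in> convex_class \<inter> C_bp p \<and>
     forward_functional c \<mu> \<nu> (\<lambda>x. ereal (\<psi> x)) = forward_dual p c \<mu> \<nu>"

definition mean :: "'a::euclidean_space measure \<Rightarrow> 'a" where
  "mean \<nu> = (\<integral>y. y \<partial>\<nu>)"

text \<open>
  Write m for the mean of nu. Every \<open>\<phi>\<close> in the dual class with \<open>\<phi> m = 0\<close> has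
  \<open>Q_c c \<phi> x \<le> c x m\<close> and, by Jensen, nonnegative nu-integral. So the values of the dual lie below
  the integral of \<open>c x m\<close> against mu, and the dual itself is at least 0, the cost being
  nonnegative. A bound on the dual is a number B that dominates that upper estimate. The weaker
  requirement that B dominate the dual value alone does not control the optimizers: on the line
  with cost \<open>(x - y)^2\<close>, for \<open>v > 2\<close>, \<open>\<epsilon> = 4 / v^2\<close> and \<open>A = 1 / \<epsilon> - 1\<close>, take
  nu with mass \<open>1 - \<epsilon>\<close> at \<open>-1\<close> and \<open>\<epsilon>\<close> at \<open>A\<close>, and mu with mass \<open>1 - \<epsilon>\<close> at \<open>-1\<close> and
  \<open>\<epsilon>\<close> at \<open>A + v / 2\<close>. The mean of nu is 0 and the dual value is 1, but
  \<open>\<phi> y = v * max 0 (y + 1) - v\<close> is an optimizer that vanishes at 0 and has \<open>Q_c c \<phi> (-1) = -v\<close>.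
\<close>

definition dual_bound ::
  "('a \<Rightarrow> 'a \<Rightarrow> real) \<Rightarrow> 'a::euclidean_space measure \<Rightarrow> 'a measure \<Rightarrow> real \<Rightarrow> bool" where
  "dual_bound c \<mu> \<nu> B \<longleftrightarrow> (\<integral>x. c x (mean \<nu>) \<partial>\<mu>) \<le> B"

end

(*
  Both transforms preserve convexity, and Q_cbar (Q_c phi) <= phi, psi <= Q_c (Q_cbar psi). Hence
  passing from phi to Q_c phi, or from psi to Q_cbar psi, never decreases the dual value, up to the
  regularity required in the backward dual. Since Q_cbar psi need not lie in C_bp p, it is replaced
  by (1 - e) times the supremum over |z| <= n of psi (y + z) - h z; letting n tend to infinity and
  then e to 0 shows that the forward values stay below the backward dual.

  For attainment, normalise a maximizing sequence phi_n to vanish at the mean m of nu. By Jensen the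
  integrals of psi_n = Q_c phi_n against mu are bounded below, while psi_n <= h (x - m). So psi_n is
  not too small at some point of a fixed ball, and convexity turns this into a bound
  psi_n >= - kappa |x| - alpha uniform in n. A subsequence of psi_n converges pointwise to a convex
  psi; dominated convergence for mu and Fatou for nu show that psi and Q_cbar psi are optimal. The
  same lower bound applied to Q_c phi gives (iii).
*)

theory Submission
  imports Defs "HOL-Complex_Analysis.Great_Picard"
begin

text \<open>The linear lower bound has to be uniform over measures that are not fixed. The quantity
  that achieves this is \<open>2 * h (x0 - m) - \<psi> x0\<close>. The dual values bound its
  integral against \<mu>, so it is bounded at some \<open>x0\<close>; as
  \<open>\<psi> x \<le> h (x - m)\<close>, one copy of \<open>h\<close> confines \<open>x0\<close>
  to a ball while the other leaves a lower bound for \<open>\<psi> x0\<close>. The obstacle is that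
  \<open>Q_cbar\<close> of a function in the dual class may be infinite on a \<nu>-null set, so the
  backward optimizer can lie outside the class whose supremum defines the dual. That it does not
  exceed this supremum is what the truncation establishes. Infinite values also require a Jensen
  inequality for functions that are not lower semicontinuous, which is derived from barycentres in
  convex sets that need not be closed.\<close>

section \<open>Barycentres in convex sets\<close>

text \<open>As \<open>C\<close> need not be closed, 0 can be separated from it only weakly. The
  separating functional is nonnegative along \<open>X\<close> with mean 0, hence vanishes almost
  everywhere, and \<open>X\<close> lives in a hyperplane section of \<open>C\<close>. Because
  \<open>a\<close> lies in \<open>span C\<close>, the section spans a smaller space, and induction
  on the dimension applies.\<close>

lemma (in prob_space) expectation_zero_in_convex:
  fixes X :: "'a \<Rightarrow> 'b::euclidean_space"
  assumes "integrable M X" "AE x in M. X x \<in> C" "convex C" "expectation X = 0"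
  shows "0 \<in> C"
  using assms
proof (induction "dim (span C)" arbitrary: C rule: less_induct)
  case less
  show ?case
  proof (rule ccontr)
    assume "0 \<notin> C"
    moreover have "C \<noteq> {}"
      using less.prems(2) AE_False by auto
    ultimately obtain a where a: "a \<in> span C" "a \<noteq> 0" "\<And>x. x \<in> C \<Longrightarrow> 0 \<le> a \<bullet> x"
      using separating_hyperplane_set_0_inspan[OF less.prems(3)] by blast
    have "AE x in M. a \<bullet> X x = 0"
    proof (subst integral_nonneg_eq_0_iff_AE[symmetric])
      show "integrable M (\<lambda>x. a \<bullet> X x)"
        using less.prems(1) by simp
      show "AE x in M. 0 \<le> a \<bullet> X x"
        using less.prems(2) a(3) by auto
      show "(\<integral>x. a \<bullet> X x \<partial>M) = 0"
        using less.prems(1,4) by simp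
    qed
    with less.prems(2) have AE: "AE x in M. X x \<in> C \<inter> {x. a \<bullet> x = 0}"
      by eventually_elim auto
    have "span (C \<inter> {x. a \<bullet> x = 0}) \<subseteq> span C \<inter> {x. a \<bullet> x = 0}"
      by (intro span_minimal subspace_inter subspace_span subspace_hyperplane)
         (auto intro: span_base)
    moreover have "a \<notin> {x. a \<bullet> x = 0}"
      using a(2) by simp
    ultimately have "span (C \<inter> {x. a \<bullet> x = 0}) \<subset> span C"
      using a(1) by blast
    then have "dim (span (C \<inter> {x. a \<bullet> x = 0})) < dim (span C)"
      by (intro dim_psubset) (simp add: span_span)
    then have "0 \<in> C \<inter> {x. a \<bullet> x = 0}"
      by (rule less.hyps)
         (use less.prems AE in \<open>auto intro: convex_Int convex_hyperplane\<close>)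
    with \<open>0 \<notin> C\<close> show False by simp
  qed
qed

lemma (in prob_space) expectation_in_convex:
  fixes X :: "'a \<Rightarrow> 'b::euclidean_space"
  assumes "integrable M X" "AE x in M. X x \<in> C" "convex C"
  shows "expectation X \<in> C"
proof -
  let ?m = "expectation X"
  have "0 \<in> (\<lambda>x. x - ?m) ` C"
  proof (rule expectation_zero_in_convex[where X = "\<lambda>x. X x - ?m"])
    show "integrable M (\<lambda>x. X x - ?m)" "expectation (\<lambda>x. X x - ?m) = 0"
      using assms(1) by (simp_all add: prob_space)
    show "AE x in M. X x - ?m \<in> (\<lambda>x. x - ?m) ` C"
      using assms(2) by auto
    show "convex ((\<lambda>x. x - ?m) ` C)"
      using assms(3) by (simp add: convex_translation_subtract)
  qed
  then show ?thesis by auto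
qed

section \<open>Real convex functions: linear bounds, Lipschitz bounds, compactness\<close>

text \<open>Suited to functions defined as infima: a strict upper bound provides a near-minimiser,
  while the value itself may not be attained.\<close>

lemma convex_on_UNIV_lessI:
  fixes f :: "'a::real_vector \<Rightarrow> real"
  assumes "\<And>t x y a b. 0 < t \<Longrightarrow> t < 1 \<Longrightarrow> f x < a \<Longrightarrow> f y < b \<Longrightarrow>
    f ((1 - t) *\<^sub>R x + t *\<^sub>R y) \<le> (1 - t) * a + t * b"
  shows "convex_on UNIV f"
proof (rule convex_onI)
  fix t :: real and x y
  assume t: "0 < t" "t < 1"
  show "f ((1 - t) *\<^sub>R x + t *\<^sub>R y) \<le> (1 - t) * f x + t * f y"
  proof (rule field_le_epsilon)
    fix e :: real assume "0 < e"
    with assms[of t x "f x + e" y "f y + e"] t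
    show "f ((1 - t) *\<^sub>R x + t *\<^sub>R y) \<le> (1 - t) * f x + t * f y + e"
      by (simp add: algebra_simps)
  qed
qed simp

lemma convex_on_UNIV_continuous:
  fixes f :: "'a::euclidean_space \<Rightarrow> real"
  shows "convex_on UNIV f \<Longrightarrow> continuous_on UNIV f"
  by (rule convex_on_continuous) auto

text \<open>The point \<open>x\<close> divides the segment from \<open>x + v\<close> to \<open>x - sgn v\<close> in the ratio \<open>norm v : 1\<close>.\<close>

lemma convex_on_linear_lower_bound:
  fixes f :: "'a::real_normed_vector \<Rightarrow> real"
  assumes f: "convex_on UNIV f" and M: "\<And>u. norm u \<le> 1 \<Longrightarrow> f (x + u) \<le> M"
  shows "(1 + norm v) * f x - norm v * M \<le> f (x + v)"
proof (cases "v = 0")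
  case False
  define s where "s = norm v"
  have s: "0 < s" using False by (simp add: s_def)
  have sv: "s *\<^sub>R sgn v = v" by (simp add: s_def sgn_div_norm False)
  define t where "t = s / (1 + s)"
  have t: "0 \<le> t" "t \<le> 1" "(1 + s) * (1 - t) = 1" "(1 + s) * t = s"
    using s by (auto simp: t_def field_simps)
  have "(1 + s) *\<^sub>R ((1 - t) *\<^sub>R (x + v) + t *\<^sub>R (x - sgn v)) = (1 + s) *\<^sub>R x"
    unfolding scaleR_add_right scaleR_scaleR t
    by (simp add: scaleR_right_diff_distrib scaleR_left_distrib sv)
  then have "(1 - t) *\<^sub>R (x + v) + t *\<^sub>R (x - sgn v) = x"
    using s by (metis add_pos_pos less_numeral_extra(1) order_less_irrefl scaleR_left_imp_eq)
  then have "f x \<le> (1 - t) * f (x + v) + t * f (x - sgn v)"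
    using convex_onD[OF f t(1,2), of "x + v" "x - sgn v"] by simp
  then have "(1 + s) * f x \<le> (1 + s) * ((1 - t) * f (x + v) + t * f (x - sgn v))"
    using s by (intro mult_left_mono) auto
  also have "\<dots> = ((1 + s) * (1 - t)) * f (x + v) + ((1 + s) * t) * f (x - sgn v)"
    by (simp add: algebra_simps)
  also have "\<dots> = f (x + v) + s * f (x - sgn v)"
    unfolding t by simp
  also have "s * f (x - sgn v) \<le> s * M"
    using s M[of "- sgn v"] by (intro mult_left_mono) (auto simp: norm_sgn)
  finally show ?thesis by (simp add: s_def)
qed simp

text \<open>A Lipschitz constant that depends on \<open>M\<close> alone, hence one for a whole
  family. A segment starting in the unit ball and prolonged to length 1 stays in the ball of radius
  2; by convexity the slope of the short piece is at most that of the long one, which is at most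
  \<open>2 * M\<close>.\<close>

lemma convex_on_abs_diff_le:
  fixes f :: "'a::real_normed_vector \<Rightarrow> real"
  assumes f: "convex_on UNIV f" and M: "\<And>u. norm u \<le> 2 \<Longrightarrow> \<bar>f (x + u)\<bar> \<le> M"
    and y: "norm (y - x) \<le> 1"
  shows "\<bar>f y - f x\<bar> \<le> 2 * M * norm (y - x)"
proof -
  have up: "f b - f a \<le> 2 * M * norm (b - a)"
    if "norm (b - a) \<le> 1" and "norm (a - x) \<le> 1" for a b
  proof (cases "b = a")
    case False
    define d where "d = norm (b - a)"
    have d: "0 < d" "d \<le> 1" using False that by (auto simp: d_def)
    have "b = (1 - d) *\<^sub>R a + d *\<^sub>R (a + sgn (b - a))"
      using d by (simp add: algebra_simps d_def sgn_div_norm)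
    then have "f b \<le> (1 - d) * f a + d * f (a + sgn (b - a))"
      using convex_onD[OF f, of d a "a + sgn (b - a)"] d by simp
    then have "f b - f a \<le> d * (f (a + sgn (b - a)) - f a)"
      by (simp add: algebra_simps)
    also have "\<dots> \<le> d * (M + M)"
    proof (rule mult_left_mono)
      have "norm ((a - x) + sgn (b - a)) \<le> 1 + 1"
        by (rule norm_triangle_mono) (use that in \<open>auto simp: norm_sgn\<close>)
      then have "\<bar>f (a + sgn (b - a))\<bar> \<le> M"
        using M[of "(a - x) + sgn (b - a)"] by simp
      moreover have "\<bar>f a\<bar> \<le> M"
        using M[of "a - x"] that by simp
      ultimately show "f (a + sgn (b - a)) - f a \<le> M + M" by linarith
    qed (use d in simp)
    finally show ?thesis by (simp add: d_def mult_ac)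
  qed simp
  show ?thesis
    using up[of y x] up[of x y] y by (simp add: abs_le_iff norm_minus_commute)
qed

text \<open>An Arzela-Ascoli argument: a subsequence converges on a countable dense set, and local
  Lipschitz constants common to all \<open>w n\<close> spread the convergence to every
  point.\<close>

lemma convex_sequence_convergent_subsequence:
  fixes w :: "nat \<Rightarrow> 'a::euclidean_space \<Rightarrow> real"
  assumes conv: "\<And>n. convex_on UNIV (w n)"
    and bd: "\<And>n x. \<bar>w n x\<bar> \<le> b x" and b: "continuous_on UNIV b"
  obtains k g where "strict_mono (k :: nat \<Rightarrow> nat)" "convex_on UNIV g"
    "\<And>x. (\<lambda>n. w (k n) x) \<longlonglongrightarrow> g x"
proof -
  obtain S :: "'a set" where S: "countable S"
    and dense: "\<And>X. open X \<Longrightarrow> X \<noteq> {} \<Longrightarrow> \<exists>s\<in>S. s \<in> X"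
    using countable_dense_setE by blast
  have b0: "0 \<le> b x" for x using bd[of 0 x] by linarith
  \<comment> \<open>The selection theorem asks for one bound valid at all points; the summand 1
    keeps the divisor positive.\<close>
  have "norm (w n x / (1 + b x)) \<le> 1" for n x
    using bd[of n x] b0[of x] by (simp add: divide_le_eq)
  then obtain k where k: "strict_mono (k :: nat \<Rightarrow> nat)"
    and lim: "\<And>x. x \<in> S \<Longrightarrow> \<exists>l. (\<lambda>n. w (k n) x / (1 + b x)) \<longlonglongrightarrow> l"
    using function_convergent_subsequence[OF S, of "\<lambda>n x. w n x / (1 + b x)" 1] by blast
  have "convergent (\<lambda>n. w (k n) x)" for x
  proof -
    have "compact (cball x 2)" by simp
    then have "bounded (b ` cball x 2)"
      by (intro compact_imp_bounded compact_continuous_image continuous_on_subset[OF b]) auto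
    then obtain M where "0 < M" "\<forall>u\<in>cball x 2. \<bar>b u\<bar> \<le> M"
      by (auto simp: bounded_pos)
    then have M: "\<And>u. u \<in> cball x 2 \<Longrightarrow> b u \<le> M" by fastforce
    have M': "\<bar>w n (x + u)\<bar> \<le> M" if "norm u \<le> 2" for u n
      using bd[of n "x + u"] M[of "x + u"] that by (simp add: dist_norm)
    have "Cauchy (\<lambda>n. w (k n) x)"
    proof (rule CauchyI)
      fix e :: real assume "0 < e"
      \<comment> \<open>With the Lipschitz constant \<open>2 * M\<close> this radius costs at most
        \<open>e / 4\<close> for each of the two indices; the Cauchy property at \<open>s\<close>
        costs another quarter.\<close>
      define r where "r = min 1 (e / (8 * M))"
      have "0 < r" using \<open>0 < e\<close> \<open>0 < M\<close> by (simp add: r_def)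
      then obtain s where s: "s \<in> S" "s \<in> ball x r"
        using dense[of "ball x r"] by auto
      then have "norm (s - x) \<le> 1" and sx: "norm (s - x) \<le> e / (8 * M)"
        by (auto simp: r_def dist_norm norm_minus_commute)
      have close: "\<bar>w n s - w n x\<bar> \<le> e / 4" for n
      proof -
        have "\<bar>w n s - w n x\<bar> \<le> 2 * M * norm (s - x)"
          by (rule convex_on_abs_diff_le[OF conv M' \<open>norm (s - x) \<le> 1\<close>])
        also have "\<dots> \<le> 2 * M * (e / (8 * M))"
          using \<open>0 < M\<close> sx by (intro mult_left_mono) auto
        finally show ?thesis using \<open>0 < M\<close> by simp
      qed
      obtain l where "(\<lambda>n. w (k n) s / (1 + b s)) \<longlonglongrightarrow> l" using lim s(1) by blast
      from tendsto_mult_right[OF this, of "1 + b s"]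
      have "(\<lambda>n. w (k n) s) \<longlonglongrightarrow> l * (1 + b s)"
        using b0[of s] by (simp add: add_nonneg_eq_0_iff)
      then have "Cauchy (\<lambda>n. w (k n) s)" by (rule LIMSEQ_imp_Cauchy)
      then obtain N where N: "\<And>m n. m \<ge> N \<Longrightarrow> n \<ge> N \<Longrightarrow> norm (w (k m) s - w (k n) s) < e / 4"
        using \<open>0 < e\<close> CauchyD[of "\<lambda>n. w (k n) s" "e / 4"] by auto
      show "\<exists>N. \<forall>m\<ge>N. \<forall>n\<ge>N. norm (w (k m) x - w (k n) x) < e"
      proof (intro exI allI impI)
        fix m n assume "N \<le> m" "N \<le> n"
        with N[of m n] close[of "k m"] close[of "k n"] \<open>0 < e\<close>
        show "norm (w (k m) x - w (k n) x) < e" unfolding real_norm_def by linarith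
      qed
    qed
    then show ?thesis by (rule Cauchy_convergent)
  qed
  then obtain g where g: "\<And>x. (\<lambda>n. w (k n) x) \<longlonglongrightarrow> g x"
    unfolding convergent_def by metis
  have "convex_on UNIV g"
  proof (rule convex_onI)
    fix t :: real and x y assume "0 < t" "t < 1"
    then show "g ((1 - t) *\<^sub>R x + t *\<^sub>R y) \<le> (1 - t) * g x + t * g y"
      by (intro LIMSEQ_le[OF g tendsto_add[OF tendsto_mult_left[OF g] tendsto_mult_left[OF g]]])
         (use convex_onD[OF conv] in auto)
  qed simp
  with k g show thesis by (blast intro: that)
qed

section \<open>The growth class \<open>C_bp\<close>\<close>

lemma C_bp_iff:
  "f \<in> C_bp p \<longleftrightarrow> continuous_on UNIV f \<and> (\<exists>K\<ge>0. \<forall>x. \<bar>f x\<bar> \<le> K * (1 + norm x powr p))"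
proof -
  have pos: "0 < 1 + norm x powr p" for x :: 'a
    by (simp add: add_pos_nonneg)
  have "bounded (range (\<lambda>x. f x / (1 + norm x powr p))) \<longleftrightarrow>
        (\<exists>K. \<forall>x. \<bar>f x\<bar> \<le> K * (1 + norm x powr p))"
    using pos by (auto simp: bounded_iff divide_le_eq abs_of_pos)
  also have "\<dots> \<longleftrightarrow> (\<exists>K\<ge>0. \<forall>x. \<bar>f x\<bar> \<le> K * (1 + norm x powr p))"
  proof
    assume "\<exists>K. \<forall>x. \<bar>f x\<bar> \<le> K * (1 + norm x powr p)"
    then obtain K where K: "\<And>x. \<bar>f x\<bar> \<le> K * (1 + norm x powr p)" by blast
    have "0 \<le> K * (1 + norm x powr p)" for x :: 'a
      using K[of x] by linarith
    with pos[of 0] have "0 \<le> K" by (metis zero_le_mult_iff linorder_not_le)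
    with K show "\<exists>K\<ge>0. \<forall>x. \<bar>f x\<bar> \<le> K * (1 + norm x powr p)" by blast
  qed blast
  finally show ?thesis by (simp add: C_bp_def)
qed

lemma C_bpI:
  assumes "continuous_on UNIV f" "\<And>x. \<bar>f x\<bar> \<le> K * (1 + norm x powr p)"
  shows "f \<in> C_bp p"
proof -
  have "K * (1 + norm x powr p) \<le> max 0 K * (1 + norm x powr p)" for x :: 'a
    by (intro mult_right_mono) auto
  with assms show ?thesis
    unfolding C_bp_iff by (intro conjI exI[of _ "max 0 K"]) (auto intro: order_trans)
qed

lemma C_bp_const: "(\<lambda>_. c) \<in> C_bp p"
  by (rule C_bpI[where K = "\<bar>c\<bar>"]) (auto simp: mult_le_cancel_left1)

lemma C_bp_add: "f \<in> C_bp p \<Longrightarrow> g \<in> C_bp p \<Longrightarrow> (\<lambda>x. f x + g x) \<in> C_bp p"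
proof (unfold C_bp_iff, elim conjE exE, intro conjI continuous_on_add)
  fix K L
  assume *: "\<forall>x. \<bar>f x\<bar> \<le> K * (1 + norm x powr p)" "\<forall>x. \<bar>g x\<bar> \<le> L * (1 + norm x powr p)"
    "0 \<le> K" "0 \<le> L"
  then show "\<exists>K\<ge>0. \<forall>x. \<bar>f x + g x\<bar> \<le> K * (1 + norm x powr p)"
    by (intro exI[of _ "K + L"]) (auto simp: distrib_right intro: order_trans[OF abs_triangle_ineq add_mono])
qed

lemma C_bp_cmult: "f \<in> C_bp p \<Longrightarrow> (\<lambda>x. c * f x) \<in> C_bp p"
proof (unfold C_bp_iff, elim conjE exE, intro conjI continuous_on_mult_left)
  fix K assume "\<forall>x. \<bar>f x\<bar> \<le> K * (1 + norm x powr p)" "0 \<le> K"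
  then show "\<exists>K\<ge>0. \<forall>x. \<bar>c * f x\<bar> \<le> K * (1 + norm x powr p)"
    by (intro exI[of _ "\<bar>c\<bar> * K"]) (auto simp: abs_mult mult.assoc intro: mult_left_mono)
qed

lemma C_bp_diff: "f \<in> C_bp p \<Longrightarrow> g \<in> C_bp p \<Longrightarrow> (\<lambda>x. f x - g x) \<in> C_bp p"
  using C_bp_add[of f p "\<lambda>x. -1 * g x"] C_bp_cmult[of g p "-1"] by simp

lemma norm_le_powr: "1 \<le> p \<Longrightarrow> norm x \<le> 1 + norm x powr p"
proof (cases "norm x \<le> 1")
  case False
  assume "1 \<le> p"
  with False have "norm x powr 1 \<le> norm x powr p" by (intro powr_mono) auto
  with False show ?thesis by simp
qed (simp add: add_increasing2)

lemma C_bp_norm: "1 \<le> p \<Longrightarrow> norm \<in> C_bp p"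
  by (rule C_bpI[where K = 1]) (auto intro: continuous_on_norm_id norm_le_powr)

lemma powr_add_le:
  fixes a b p :: real
  assumes "0 \<le> a" "0 \<le> b" "0 \<le> p"
  shows "(a + b) powr p \<le> 2 powr p * (a powr p + b powr p)"
proof -
  have "(a + b) powr p \<le> (2 * max a b) powr p"
    using assms by (intro powr_mono2) auto
  also have "\<dots> = 2 powr p * max a b powr p"
    using assms by (subst powr_mult) auto
  also have "\<dots> \<le> 2 powr p * (a powr p + b powr p)"
    by (intro mult_left_mono) (auto simp: max_def)
  finally show ?thesis .
qed

text \<open>In product form, so that for \<open>y\<close> fixed or confined to a ball the first
  factor is a constant; this serves translations and the truncated supremum alike.\<close>

lemma one_plus_powr_norm_add_le:
  assumes "1 \<le> p"
  shows "1 + norm (x + y) powr p \<le> 2 powr p * (1 + norm y powr p) * (1 + norm x powr p)"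
proof -
  have "norm (x + y) powr p \<le> (norm x + norm y) powr p"
    using assms by (intro powr_mono2 norm_triangle_ineq) auto
  also have "\<dots> \<le> 2 powr p * (norm x powr p + norm y powr p)"
    using assms by (intro powr_add_le) auto
  finally have "1 + norm (x + y) powr p \<le> 1 + 2 powr p * (norm x powr p + norm y powr p)" by simp
  also have "\<dots> \<le> 2 powr p * 1 + 2 powr p * (norm x powr p + norm y powr p)"
    using assms by (simp add: ge_one_powr_ge_zero)
  also have "\<dots> \<le> 2 powr p * ((1 + norm y powr p) * (1 + norm x powr p))"
    unfolding distrib_left[symmetric]
    by (intro mult_left_mono) (auto simp: algebra_simps)
  finally show ?thesis by (simp add: mult.assoc)
qed

lemma C_bp_shift:
  assumes "1 \<le> p" "f \<in> C_bp p"
  shows "(\<lambda>x. f (x + y)) \<in> C_bp p"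
proof -
  from assms(2) obtain K where K: "0 \<le> K" "\<And>x. \<bar>f x\<bar> \<le> K * (1 + norm x powr p)"
    and f: "continuous_on UNIV f" by (auto simp: C_bp_iff)
  show ?thesis
  proof (rule C_bpI)
    show "continuous_on UNIV (\<lambda>x. f (x + y))"
      by (rule continuous_on_compose2[OF f]) (auto intro: continuous_intros)
    fix x
    have "\<bar>f (x + y)\<bar> \<le> K * (1 + norm (x + y) powr p)" by (rule K)
    also have "\<dots> \<le> K * (2 powr p * (1 + norm y powr p) * (1 + norm x powr p))"
      by (intro mult_left_mono one_plus_powr_norm_add_le assms K)
    finally show "\<bar>f (x + y)\<bar> \<le> K * (2 powr p * (1 + norm y powr p)) * (1 + norm x powr p)"
      by (simp add: mult.assoc)
  qed
qed

lemma C_bp_integrable: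
  assumes "M \<in> P_space p" "f \<in> C_bp p"
  shows "integrable M f"
proof -
  interpret prob_space M using assms(1) by (simp add: P_space_def)
  have [measurable_cong]: "sets M = sets borel" using assms(1) by (simp add: P_space_def)
  obtain K where K: "\<And>x. \<bar>f x\<bar> \<le> K * (1 + norm x powr p)" and f: "continuous_on UNIV f"
    using assms(2) by (auto simp: C_bp_iff)
  have [measurable]: "f \<in> borel_measurable borel"
    by (rule borel_measurable_continuous_onI) fact
  show ?thesis
  proof (rule Bochner_Integration.integrable_bound)
    show "integrable M (\<lambda>x. K * (1 + norm x powr p))"
      using assms(1) by (simp add: P_space_def)
    show "AE x in M. norm (f x) \<le> norm (K * (1 + norm x powr p))"
      using K by (auto intro!: AE_I2 order_trans[OF _ abs_ge_self])
  qed measurable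
qed

lemma P_space_integrable_id:
  assumes "1 \<le> p" "M \<in> P_space p"
  shows "integrable M (\<lambda>x. x)"
proof -
  have [measurable_cong]: "sets M = sets borel" using assms(2) by (simp add: P_space_def)
  show ?thesis
    by (rule Bochner_Integration.integrable_bound[OF C_bp_integrable[OF assms(2) C_bp_norm[OF assms(1)]]]) auto
qed

text \<open>A convex function decreases at most linearly, and for \<open>1 \<le> p\<close> linear
  decrease is within the allowed growth; so the upper bound controls the absolute value.\<close>

lemma convex_growth_C_bp:
  fixes f :: "'a::euclidean_space \<Rightarrow> real"
  assumes p: "1 \<le> p" and f: "convex_on UNIV f"
    and K: "0 \<le> K" and le: "\<And>x. f x \<le> K * (1 + norm x powr p)"
  shows "f \<in> C_bp p"
proof -
  have cont: "continuous_on UNIV f" by (rule convex_on_UNIV_continuous) fact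
  have "bounded (f ` cball 0 1)"
    by (intro compact_imp_bounded compact_continuous_image continuous_on_subset[OF cont]) auto
  then obtain M where "0 < M" "\<forall>x\<in>cball 0 1. \<bar>f x\<bar> \<le> M"
    by (auto simp: bounded_pos)
  then have M: "\<And>u. norm u \<le> 1 \<Longrightarrow> \<bar>f u\<bar> \<le> M" by simp
  have lb: "- (M + 2 * M * norm x) \<le> f x" for x
  proof -
    have "(1 + norm x) * f 0 - norm x * M \<le> f (0 + x)"
      by (rule convex_on_linear_lower_bound[OF f]) (use M in \<open>auto simp: abs_le_iff\<close>)
    moreover have "(1 + norm x) * (- M) \<le> (1 + norm x) * f 0"
      using M[of 0] by (intro mult_left_mono) auto
    ultimately show ?thesis by (simp add: algebra_simps)
  qed
  show ?thesis
  proof (rule C_bpI[OF cont])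
    fix x :: 'a
    have "M * norm x \<le> M * (1 + norm x powr p)"
      using norm_le_powr[OF p, of x] \<open>0 < M\<close> by (intro mult_left_mono) auto
    moreover have "M \<le> M * (1 + norm x powr p)"
      using \<open>0 < M\<close> by (simp add: mult_le_cancel_left1)
    moreover have "0 \<le> K * (1 + norm x powr p)"
      using K by simp
    ultimately show "\<bar>f x\<bar> \<le> (K + 3 * M) * (1 + norm x powr p)"
      using lb[of x] le[of x] \<open>0 < M\<close>
      unfolding distrib_right mult.assoc by (intro abs_leI) linarith+
  qed
qed

corollary convex_le_C_bp:
  fixes f :: "'a::euclidean_space \<Rightarrow> real"
  assumes "1 \<le> p" "convex_on UNIV f" "g \<in> C_bp p" "\<And>x. f x \<le> g x"
  shows "f \<in> C_bp p"
proof -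
  obtain K where K: "0 \<le> K" "\<And>x. \<bar>g x\<bar> \<le> K * (1 + norm x powr p)"
    using assms(3) by (auto simp: C_bp_iff)
  show ?thesis
    using assms(4) abs_le_D1[OF K(2)] by (intro convex_growth_C_bp[OF assms(1,2) K(1)]) (rule order_trans)
qed

section \<open>Extended-valued convex functions, their integrals, and Jensen's inequality\<close>

text \<open>Split off from \<open>convex_L1\<close> because \<open>Q_cbar\<close> is convex before
  anything is known about its integrability. Excluding \<open>-\<infinity>\<close> keeps opposite
  infinities out of the right-hand side.\<close>

definition ext_convex :: "('a::real_vector \<Rightarrow> ereal) \<Rightarrow> bool" where
  "ext_convex \<phi> \<longleftrightarrow> (\<forall>x. \<phi> x \<noteq> -\<infinity>) \<and>
     (\<forall>x y. \<forall>t\<in>{0<..<1::real}.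
        \<phi> ((1 - t) *\<^sub>R x + t *\<^sub>R y) \<le> ereal (1 - t) * \<phi> x + ereal t * \<phi> y)"

lemma convex_L1_iff:
  "\<phi> \<in> convex_L1 \<nu> \<longleftrightarrow>
     ext_convex \<phi> \<and> \<phi> \<in> borel_measurable \<nu> \<and> (\<integral>\<^sup>+x. e2ennreal \<bar>\<phi> x\<bar> \<partial>\<nu>) < \<infinity>"
  by (auto simp: convex_L1_def ext_convex_def)

lemma ext_convex_ereal: "convex_on UNIV f \<Longrightarrow> ext_convex (\<lambda>x. ereal (f x))"
  using convex_onD[of UNIV f] by (auto simp: ext_convex_def)

lemma ext_convex_leD:
  assumes "ext_convex \<phi>" "0 < t" "t < 1" "\<phi> x \<le> ereal a" "\<phi> y \<le> ereal b"
  shows "\<phi> ((1 - t) *\<^sub>R x + t *\<^sub>R y) \<le> ereal ((1 - t) * a + t * b)"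
proof -
  have "\<phi> ((1 - t) *\<^sub>R x + t *\<^sub>R y) \<le> ereal (1 - t) * \<phi> x + ereal t * \<phi> y"
    using assms(1-3) by (auto simp: ext_convex_def)
  also have "\<dots> \<le> ereal (1 - t) * ereal a + ereal t * ereal b"
    using assms by (intro add_mono ereal_mult_left_mono) auto
  finally show ?thesis by simp
qed

lemma ext_integral_real:
  assumes "integrable M f"
  shows "ext_integral M (\<lambda>x. ereal (f x)) = ereal (\<integral>x. f x \<partial>M)"
proof -
  have "(\<integral>\<^sup>+x. ennreal (f x) \<partial>M) \<noteq> \<infinity>" "(\<integral>\<^sup>+x. ennreal (- f x) \<partial>M) \<noteq> \<infinity>"
    using assms by (auto simp: real_integrable_def)
  then show ?thesis
    unfolding ext_integral_def real_lebesgue_integral_def[OF assms]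
    by (cases "\<integral>\<^sup>+x. ennreal (f x) \<partial>M"; cases "\<integral>\<^sup>+x. ennreal (- f x) \<partial>M")
       (auto simp: enn2ereal_ennreal)
qed

lemma ext_integral_cong_AE:
  assumes "AE x in M. f x = g x"
  shows "ext_integral M f = ext_integral M g"
  unfolding ext_integral_def
  by (intro arg_cong2[where f = "(-)"] arg_cong[where f = enn2ereal] nn_integral_cong_AE)
     (use assms in \<open>auto elim: eventually_mono\<close>)

text \<open>The bridge to Bochner integrals. \<open>real_of_ereal\<close> turns infinite values into
  0, but here only on a null set.\<close>

lemma convex_L1_real:
  assumes "\<phi> \<in> convex_L1 \<nu>"
  shows "AE x in \<nu>. \<phi> x = ereal (real_of_ereal (\<phi> x))"
    and "integrable \<nu> (\<lambda>x. real_of_ereal (\<phi> x))"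
    and "ext_integral \<nu> \<phi> = ereal (\<integral>x. real_of_ereal (\<phi> x) \<partial>\<nu>)"
proof -
  have [measurable]: "\<phi> \<in> borel_measurable \<nu>" and fin: "(\<integral>\<^sup>+x. e2ennreal \<bar>\<phi> x\<bar> \<partial>\<nu>) < \<infinity>"
    using assms by (auto simp: convex_L1_iff)
  have "AE x in \<nu>. e2ennreal \<bar>\<phi> x\<bar> \<noteq> \<infinity>"
    using fin by (intro nn_integral_noteq_infinite) auto
  then show AE: "AE x in \<nu>. \<phi> x = ereal (real_of_ereal (\<phi> x))"
  proof eventually_elim
    case (elim x)
    then show ?case by (cases "\<phi> x") auto
  qed
  show int: "integrable \<nu> (\<lambda>x. real_of_ereal (\<phi> x))"
  proof (rule integrableI_bounded)
    have "(\<integral>\<^sup>+x. ennreal (norm (real_of_ereal (\<phi> x))) \<partial>\<nu>) \<le> (\<integral>\<^sup>+x. e2ennreal \<bar>\<phi> x\<bar> \<partial>\<nu>)"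
    proof (rule nn_integral_mono)
      fix x show "ennreal (norm (real_of_ereal (\<phi> x))) \<le> e2ennreal \<bar>\<phi> x\<bar>"
        by (cases "\<phi> x") auto
    qed
    with fin show "(\<integral>\<^sup>+x. ennreal (norm (real_of_ereal (\<phi> x))) \<partial>\<nu>) < \<infinity>" by auto
  qed measurable
  show "ext_integral \<nu> \<phi> = ereal (\<integral>x. real_of_ereal (\<phi> x) \<partial>\<nu>)"
    using ext_integral_cong_AE[OF AE] ext_integral_real[OF int] by simp
qed

lemma convex_L1_ereal:
  assumes "convex_on UNIV f" "integrable \<nu> f"
  shows "(\<lambda>x. ereal (f x)) \<in> convex_L1 \<nu>"
  using assms by (auto simp: convex_L1_iff ext_convex_ereal integrable_iff_bounded)

lemma Pair_bochner_integral:
  fixes f :: "'a \<Rightarrow> 'b::euclidean_space" and g :: "'a \<Rightarrow> 'c::euclidean_space"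
  assumes f: "integrable M f" and g: "integrable M g"
  shows "integrable M (\<lambda>x. (f x, g x))"
    and "(\<integral>x. (f x, g x) \<partial>M) = (\<integral>x. f x \<partial>M, \<integral>x. g x \<partial>M)"
proof -
  have "integrable M (\<lambda>x. (f x, 0) + (0, g x))"
    by (intro Bochner_Integration.integrable_add integrable_bounded_linear[OF _ f]
          integrable_bounded_linear[OF _ g] bounded_linear_Pair bounded_linear_ident bounded_linear_zero)
  then show int: "integrable M (\<lambda>x. (f x, g x))" by simp
  show "(\<integral>x. (f x, g x) \<partial>M) = (\<integral>x. f x \<partial>M, \<integral>x. g x \<partial>M)"
    using integral_bounded_linear[OF bounded_linear_fst int]
      integral_bounded_linear[OF bounded_linear_snd int]
    by (simp add: prod_eq_iff)
qed

text \<open>No supporting affine function need exist here: \<open>\<phi>\<close> may fail to be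
  lower semicontinuous, and the mean may lie on the relative boundary of its domain.\<close>

lemma jensen_convex_L1:
  assumes p: "1 \<le> p" and \<nu>: "\<nu> \<in> P_space p" and \<phi>: "\<phi> \<in> convex_L1 \<nu>"
  shows "\<phi> (mean \<nu>) \<le> ereal (\<integral>y. real_of_ereal (\<phi> y) \<partial>\<nu>)"
proof -
  interpret prob_space \<nu> using \<nu> by (simp add: P_space_def)
  \<comment> \<open>The epigraph, convex but perhaps not closed. It contains almost every graph
    point, hence their barycentre, and that membership is the claim.\<close>
  define C where "C = {(y, s). \<phi> y \<le> ereal s}"
  have conv: "ext_convex \<phi>" using \<phi> by (simp add: convex_L1_iff)
  have "convex C"
    unfolding convex_alt
  proof safe
    fix x y s r and u :: real
    assume "(x, s) \<in> C" "(y, r) \<in> C" "0 \<le> u" "u \<le> 1"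
    then show "(1 - u) *\<^sub>R (x, s) + u *\<^sub>R (y, r) \<in> C"
      using ext_convex_leD[OF conv, of u x s y r]
      by (cases "u = 0"; cases "u = 1") (auto simp: C_def)
  qed
  moreover have "integrable \<nu> (\<lambda>y. (y, real_of_ereal (\<phi> y)))"
    by (intro Pair_bochner_integral P_space_integrable_id[OF p \<nu>] convex_L1_real \<phi>)
  moreover have "AE y in \<nu>. (y, real_of_ereal (\<phi> y)) \<in> C"
    using convex_L1_real(1)[OF \<phi>] by eventually_elim (simp add: C_def)
  ultimately have "expectation (\<lambda>y. (y, real_of_ereal (\<phi> y))) \<in> C"
    by (intro expectation_in_convex)
  also have "expectation (\<lambda>y. (y, real_of_ereal (\<phi> y))) =
      (mean \<nu>, \<integral>y. real_of_ereal (\<phi> y) \<partial>\<nu>)"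
    unfolding mean_def
    by (intro Pair_bochner_integral P_space_integrable_id[OF p \<nu>] convex_L1_real \<phi>)
  finally show ?thesis by (simp add: C_def)
qed

section \<open>The transforms and the cost\<close>

lemma Q_c_le: "Q_c c \<phi> x \<le> \<phi> y + ereal (c x y)"
  unfolding Q_c_def by (rule INF_lower) simp

lemma Q_cbar_ge: "\<psi> x - ereal (c x y) \<le> Q_cbar c \<psi> y"
  unfolding Q_cbar_def by (rule SUP_upper) simp

lemma Q_c_Q_cbar_ge: "ereal (f x) \<le> Q_c c (Q_cbar c (\<lambda>x. ereal (f x))) x"
  unfolding Q_c_def
proof (rule INF_greatest)
  fix y
  show "ereal (f x) \<le> Q_cbar c (\<lambda>x. ereal (f x)) y + ereal (c x y)"
    using Q_cbar_ge[of "\<lambda>x. ereal (f x)" x c y]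
    by (cases "Q_cbar c (\<lambda>x. ereal (f x)) y") auto
qed

lemma Q_cbar_Q_c_le: "Q_c c \<phi> = (\<lambda>x. ereal (u x)) \<Longrightarrow> Q_cbar c (\<lambda>x. ereal (u x)) y \<le> \<phi> y"
  unfolding Q_cbar_def
proof (rule SUP_least)
  fix x
  assume "Q_c c \<phi> = (\<lambda>x. ereal (u x))"
  then have "ereal (u x) \<le> \<phi> y + ereal (c x y)" using Q_c_le[of c \<phi> x y] by metis
  then show "ereal (u x) - ereal (c x y) \<le> \<phi> y"
    by (cases "\<phi> y") auto
qed

locale admissible_cost =
  fixes p :: real and h :: "'a::euclidean_space \<Rightarrow> real"
  assumes p: "1 \<le> p" and admissible: "admissible p h"
begin

lemma h_nonneg: "0 \<le> h z"
  using admissible by (simp add: admissible_def)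

lemma h_convex: "convex_on UNIV h"
proof (rule convex_onI)
  fix t :: real and x y :: 'a
  assume "0 < t" "t < 1"
  with admissible show "h ((1 - t) *\<^sub>R x + t *\<^sub>R y) \<le> (1 - t) * h x + t * h y"
    by (cases "x = y")
       (auto simp: admissible_def strictly_convex_def algebra_simps intro!: less_imp_le)
qed simp

lemma h_continuous: "continuous_on UNIV h"
  by (rule convex_on_UNIV_continuous[OF h_convex])

text \<open>The positive infimum gives the slope \<delta> outside the ball of radius
  \<open>a\<close>; the offset \<open>\<delta> * a\<close> covers the inside by nonnegativity of
  \<open>h\<close>.\<close>

lemma h_coercive:
  obtains \<delta> C where "0 < \<delta>" "0 \<le> C" "\<And>z. \<delta> * norm z - C \<le> h z"
proof -
  obtain a where a: "0 < a" and "0 < (INF z\<in>{z. a \<le> norm z}. ereal (h z / norm z))"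
    using admissible by (auto simp: admissible_def)
  then obtain \<delta> where "0 < \<delta>" and \<delta>: "ereal \<delta> < (INF z\<in>{z. a \<le> norm z}. ereal (h z / norm z))"
    using ereal_dense2 by fastforce
  have "\<delta> * norm z - \<delta> * a \<le> h z" for z
  proof (cases "a \<le> norm z")
    case True
    then have "ereal \<delta> < ereal (h z / norm z)"
      by (intro less_INF_D[OF \<delta>]) simp
    moreover have "0 < norm z" using a True by linarith
    ultimately have "\<delta> * norm z \<le> h z" by (simp add: less_divide_eq)
    with mult_pos_pos[OF \<open>0 < \<delta>\<close> a] show ?thesis by linarith
  next
    case False
    then have "\<delta> * norm z \<le> \<delta> * a" using \<open>0 < \<delta>\<close> by simp
    with h_nonneg[of z] show ?thesis by linarith
  qed
  with \<open>0 < \<delta>\<close> a show thesis by (intro that[of \<delta> "\<delta> * a"]) auto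
qed

lemma h_C_bp: "h \<in> C_bp p"
proof -
  obtain a where a: "0 < a" and sup: "(SUP z\<in>{z. a \<le> norm z}. ereal (h z / norm z powr p)) < \<infinity>"
    using admissible by (auto simp: admissible_def)
  obtain L where L: "(SUP z\<in>{z. a \<le> norm z}. ereal (h z / norm z powr p)) < ereal L"
    using sup less_PInf_Ex_of_nat ereal_dense2 by blast
  have "bounded (h ` cball 0 a)"
    by (intro compact_imp_bounded compact_continuous_image continuous_on_subset[OF h_continuous]) auto
  then obtain M where "0 < M" and M': "\<forall>x\<in>cball 0 a. \<bar>h x\<bar> \<le> M"
    by (auto simp: bounded_pos)
  have M: "h z \<le> M" if "norm z \<le> a" for z using that M'[rule_format, of z] by simp
  show ?thesis
  proof (rule C_bpI[OF h_continuous])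
    fix z :: 'a
    have pos: "0 < 1 + norm z powr p" by (simp add: add_pos_nonneg)
    have "h z \<le> (max 0 L + M) * (1 + norm z powr p)"
    proof (cases "a \<le> norm z")
      case True
      then have "ereal (h z / norm z powr p) < ereal L"
        by (intro SUP_lessD[OF L]) simp
      moreover have "0 < norm z powr p" using a True by auto
      ultimately have "h z \<le> L * norm z powr p" by (simp add: divide_less_eq)
      also have "\<dots> \<le> (max 0 L + M) * (1 + norm z powr p)"
        using \<open>0 < M\<close> by (intro mult_mono) auto
      finally show ?thesis .
    next
      case False
      have "h z \<le> M * 1" using M[of z] False by simp
      also have "\<dots> \<le> (max 0 L + M) * (1 + norm z powr p)"
        using \<open>0 < M\<close> by (intro mult_mono) auto
      finally show ?thesis .
    qed
    with h_nonneg[of z] show "\<bar>h z\<bar> \<le> (max 0 L + M) * (1 + norm z powr p)" by simp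
  qed
qed

lemma cost_C_bp: "(\<lambda>x. h (x - y)) \<in> C_bp p"
  using C_bp_shift[OF p h_C_bp, of "- y"] by simp

text \<open>\<open>\<phi> y + h (x - y)\<close> is jointly convex in \<open>x\<close> and
  \<open>y\<close>, so its infimum over \<open>y\<close> is convex in \<open>x\<close>. Strict
  bounds provide near-minimisers and make sense also where the infimum is
  \<open>-\<infinity>\<close>.\<close>

lemma Q_c_convex_less:
  assumes \<phi>: "ext_convex \<phi>" and t: "0 < t" "t < 1"
    and a: "Q_c (cost h) \<phi> x1 < ereal a" and b: "Q_c (cost h) \<phi> x2 < ereal b"
  shows "Q_c (cost h) \<phi> ((1 - t) *\<^sub>R x1 + t *\<^sub>R x2) < ereal ((1 - t) * a + t * b)"
proof -
  obtain y1 where y1: "\<phi> y1 + ereal (h (x1 - y1)) < ereal a"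
    using a by (auto simp: Q_c_def cost_def INF_less_iff)
  obtain y2 where y2: "\<phi> y2 + ereal (h (x2 - y2)) < ereal b"
    using b by (auto simp: Q_c_def cost_def INF_less_iff)
  have "\<phi> y1 \<noteq> -\<infinity>" "\<phi> y2 \<noteq> -\<infinity>" using \<phi> by (auto simp: ext_convex_def)
  with y1 y2 obtain r1 r2 where r: "\<phi> y1 = ereal r1" "\<phi> y2 = ereal r2"
    by (cases "\<phi> y1"; cases "\<phi> y2") auto
  let ?x = "(1 - t) *\<^sub>R x1 + t *\<^sub>R x2" and ?y = "(1 - t) *\<^sub>R y1 + t *\<^sub>R y2"
  have "?x - ?y = (1 - t) *\<^sub>R (x1 - y1) + t *\<^sub>R (x2 - y2)"
    by (simp add: algebra_simps)
  then have "h (?x - ?y) \<le> (1 - t) * h (x1 - y1) + t * h (x2 - y2)"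
    using convex_onD[OF h_convex, of t "x1 - y1" "x2 - y2"] t by simp
  moreover have "\<phi> ?y \<le> ereal ((1 - t) * r1 + t * r2)"
    using r t by (intro ext_convex_leD[OF \<phi>]) auto
  ultimately have "\<phi> ?y + ereal (h (?x - ?y)) \<le>
      ereal ((1 - t) * r1 + t * r2) + ereal ((1 - t) * h (x1 - y1) + t * h (x2 - y2))"
    by (intro add_mono) auto
  also have "\<dots> = ereal ((1 - t) * (r1 + h (x1 - y1)) + t * (r2 + h (x2 - y2)))"
    by (simp add: algebra_simps)
  also have "\<dots> < ereal ((1 - t) * a + t * b)"
    using y1 y2 r t by (auto intro!: add_strict_mono)
  finally show ?thesis
    using Q_c_le[of "cost h" \<phi> ?x ?y] by (auto simp: cost_def intro: le_less_trans)
qed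

text \<open>A convex function below \<infinity> everywhere that equals \<open>-\<infinity>\<close>
  at one point does so everywhere, each \<open>x\<close> being the midpoint of \<open>x1\<close> and
  its reflection. Otherwise the transform is real, and a translate of the cost plus a constant
  bounds it from above, which places it in \<open>C_bp p\<close>.\<close>

lemma Q_c_cases:
  assumes \<phi>: "ext_convex \<phi>" and y0: "\<phi> y0 \<noteq> \<infinity>"
  obtains "Q_c (cost h) \<phi> = (\<lambda>_. -\<infinity>)"
  | u where "u \<in> convex_class \<inter> C_bp p" "Q_c (cost h) \<phi> = (\<lambda>x. ereal (u x))"
proof (cases "\<exists>x1. Q_c (cost h) \<phi> x1 = -\<infinity>")
  case True
  then obtain x1 where x1: "Q_c (cost h) \<phi> x1 = -\<infinity>" by blast
  obtain r where r: "\<phi> y0 = ereal r"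
    using \<phi> y0 by (cases "\<phi> y0") (auto simp: ext_convex_def)
  have "Q_c (cost h) \<phi> x = -\<infinity>" for x
  proof (rule ereal_bot)
    fix c
    \<comment> \<open>A strict bound at the reflected point. At \<open>x1\<close> the bound
      \<open>2 * c - b\<close> is available, and the two average to \<open>c\<close>.\<close>
    define b where "b = r + h (2 *\<^sub>R x - x1 - y0) + 1"
    have "Q_c (cost h) \<phi> (2 *\<^sub>R x - x1) \<le> ereal (r + h (2 *\<^sub>R x - x1 - y0))"
      using Q_c_le[of "cost h" \<phi> "2 *\<^sub>R x - x1" y0] by (simp add: r cost_def)
    also have "\<dots> < ereal b" by (simp add: b_def)
    finally have "Q_c (cost h) \<phi> ((1 - 1 / 2) *\<^sub>R x1 + (1 / 2) *\<^sub>R (2 *\<^sub>R x - x1))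
        < ereal ((1 - 1 / 2) * (2 * c - b) + 1 / 2 * b)"
      using x1 by (intro Q_c_convex_less[OF \<phi>]) auto
    then show "Q_c (cost h) \<phi> x \<le> ereal c"
      by (simp add: algebra_simps)
  qed
  then show ?thesis by (intro that(1)) auto
next
  case False
  obtain r where r: "\<phi> y0 = ereal r"
    using \<phi> y0 by (cases "\<phi> y0") (auto simp: ext_convex_def)
  define u where "u x = real_of_ereal (Q_c (cost h) \<phi> x)" for x
  have le: "Q_c (cost h) \<phi> x \<le> ereal (r + h (x - y0))" for x
    using Q_c_le[of "cost h" \<phi> x y0] by (simp add: r cost_def)
  have u: "Q_c (cost h) \<phi> x = ereal (u x)" for x
    using False le[of x] by (cases "Q_c (cost h) \<phi> x") (auto simp: u_def)
  have conv: "convex_on UNIV u"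
  proof (rule convex_on_UNIV_lessI)
    fix t a b :: real and x y assume "0 < t" "t < 1" "u x < a" "u y < b"
    then have "Q_c (cost h) \<phi> ((1 - t) *\<^sub>R x + t *\<^sub>R y) < ereal ((1 - t) * a + t * b)"
      by (intro Q_c_convex_less[OF \<phi>]) (auto simp: u)
    then show "u ((1 - t) *\<^sub>R x + t *\<^sub>R y) \<le> (1 - t) * a + t * b" by (simp add: u)
  qed
  have "u \<in> C_bp p"
    by (rule convex_le_C_bp[OF p conv C_bp_add[OF C_bp_const cost_C_bp]])
       (use le in \<open>auto simp: u\<close>)
  with conv u show ?thesis by (intro that(2)[of u]) (auto simp: convex_class_def)
qed

text \<open>Substituting \<open>z = x - y\<close> frees the cost of \<open>y\<close>: what remains
  is a supremum of translates of \<open>f\<close> minus constants, from which convexity and lower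
  semicontinuity can be read off.\<close>

lemma Q_cbar_shift: "Q_cbar (cost h) (\<lambda>x. ereal (f x)) y = (SUP z. ereal (f (y + z) - h z))"
proof -
  have "Q_cbar (cost h) (\<lambda>x. ereal (f x)) y = (SUP x. ereal (f x - h (x - y)))"
    by (simp add: Q_cbar_def cost_def)
  also have "\<dots> = (SUP z. ereal (f (y + z) - h z))"
  proof (rule SUP_eq)
    fix x show "\<exists>z\<in>UNIV. ereal (f x - h (x - y)) \<le> ereal (f (y + z) - h z)"
      by (intro bexI[of _ "x - y"]) auto
  next
    fix z show "\<exists>x\<in>UNIV. ereal (f (y + z) - h z) \<le> ereal (f x - h (x - y))"
      by (intro bexI[of _ "y + z"]) auto
  qed
  finally show ?thesis .
qed

lemma Q_cbar_ext_convex: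
  assumes f: "convex_on UNIV f"
  shows "ext_convex (Q_cbar (cost h) (\<lambda>x. ereal (f x)))" (is "ext_convex ?\<phi>")
  unfolding ext_convex_def
proof (intro conjI allI ballI)
  show "?\<phi> y \<noteq> -\<infinity>" for y
    using Q_cbar_ge[of "\<lambda>x. ereal (f x)" y "cost h" y] by auto
  fix x y and t :: real assume t: "t \<in> {0<..<1}"
  show "?\<phi> ((1 - t) *\<^sub>R x + t *\<^sub>R y) \<le> ereal (1 - t) * ?\<phi> x + ereal t * ?\<phi> y"
    unfolding Q_cbar_shift[of f "(1 - t) *\<^sub>R x + t *\<^sub>R y"]
  proof (rule SUP_least)
    fix z
    have "(1 - t) *\<^sub>R x + t *\<^sub>R y + z = (1 - t) *\<^sub>R (x + z) + t *\<^sub>R (y + z)"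
      by (simp add: algebra_simps)
    then have "f ((1 - t) *\<^sub>R x + t *\<^sub>R y + z) \<le> (1 - t) * f (x + z) + t * f (y + z)"
      using convex_onD[OF f, of t "x + z" "y + z"] t by simp
    then have "ereal (f ((1 - t) *\<^sub>R x + t *\<^sub>R y + z) - h z)
        \<le> ereal (1 - t) * ereal (f (x + z) - h z) + ereal t * ereal (f (y + z) - h z)"
      by (simp add: algebra_simps)
    also have "\<dots> \<le> ereal (1 - t) * ?\<phi> x + ereal t * ?\<phi> y"
      using t unfolding Q_cbar_shift
      by (intro add_mono ereal_mult_left_mono SUP_upper) auto
    finally show "ereal (f ((1 - t) *\<^sub>R x + t *\<^sub>R y + z) - h z) \<le> \<dots>" .
  qed
qed

text \<open>The supremum is over uncountably many \<open>z\<close>, but of functions continuous in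
  \<open>y\<close>, so its strict superlevel sets are open.\<close>

lemma Q_cbar_borel:
  assumes f: "continuous_on UNIV f"
  shows "Q_cbar (cost h) (\<lambda>x. ereal (f x)) \<in> borel_measurable borel" (is "?\<phi> \<in> _")
proof (rule borel_measurableI_greater)
  fix a
  have "{y. a < ?\<phi> y} = (\<Union>z. {y. a < ereal (f (y + z) - h z)})"
    by (auto simp: Q_cbar_shift less_SUP_iff)
  also have "open \<dots>"
    by (intro open_UN ballI open_Collect_less continuous_intros continuous_on_ereal
          continuous_on_compose2[OF f]) auto
  finally show "{y \<in> space borel. a < ?\<phi> y} \<in> sets borel" by auto
qed

end

section \<open>Integrability from a minorant, and the uniform linear lower bound\<close>

text \<open>Shaped for the output of Fatou's lemma, a bound on a nonnegative integral: subtracting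
  the integrable minorant \<open>l\<close> makes the integrand nonnegative, and adding it back gives
  integrability together with the bound.\<close>

lemma convex_L1I_nn_integral_le:
  assumes conv: "ext_convex \<phi>" and [measurable]: "\<phi> \<in> borel_measurable \<nu>"
    and l: "integrable \<nu> l" and le: "\<And>y. ereal (l y) \<le> \<phi> y"
    and c: "(\<integral>\<^sup>+y. e2ennreal (\<phi> y - ereal (l y)) \<partial>\<nu>) \<le> ennreal c" "0 \<le> c"
  shows "\<phi> \<in> convex_L1 \<nu>" and "(\<integral>y. real_of_ereal (\<phi> y) \<partial>\<nu>) \<le> c + (\<integral>y. l y \<partial>\<nu>)"
proof -
  have [measurable]: "l \<in> borel_measurable \<nu>" using l by auto
  have "(\<integral>\<^sup>+y. e2ennreal \<bar>\<phi> y\<bar> \<partial>\<nu>) \<le> (\<integral>\<^sup>+y. e2ennreal (\<phi> y - ereal (l y)) + ennreal \<bar>l y\<bar> \<partial>\<nu>)"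
  proof (rule nn_integral_mono)
    fix y
    show "e2ennreal \<bar>\<phi> y\<bar> \<le> e2ennreal (\<phi> y - ereal (l y)) + ennreal \<bar>l y\<bar>"
      using le[of y] by (cases "\<phi> y") (auto simp flip: ennreal_plus)
  qed
  also have "\<dots> = (\<integral>\<^sup>+y. e2ennreal (\<phi> y - ereal (l y)) \<partial>\<nu>) + (\<integral>\<^sup>+y. ennreal \<bar>l y\<bar> \<partial>\<nu>)"
    by (rule nn_integral_add) auto
  also have "\<dots> < \<infinity>"
    using c(1) l by (auto simp: integrable_iff_bounded top_unique less_top intro: le_less_trans)
  finally show L1: "\<phi> \<in> convex_L1 \<nu>" using conv by (simp add: convex_L1_iff)
  have int: "integrable \<nu> (\<lambda>y. real_of_ereal (\<phi> y) - l y)"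
    using convex_L1_real(2)[OF L1] l by simp
  have AE: "AE y in \<nu>. 0 \<le> real_of_ereal (\<phi> y) - l y"
    using convex_L1_real(1)[OF L1]
  proof eventually_elim
    case (elim y)
    with le[of y] show ?case by (metis diff_ge_0_iff_ge ereal_less_eq(3))
  qed
  have "ennreal (\<integral>y. real_of_ereal (\<phi> y) - l y \<partial>\<nu>) = (\<integral>\<^sup>+y. ennreal (real_of_ereal (\<phi> y) - l y) \<partial>\<nu>)"
    using nn_integral_eq_integral[OF int AE] by simp
  also have "\<dots> = (\<integral>\<^sup>+y. e2ennreal (\<phi> y - ereal (l y)) \<partial>\<nu>)"
  proof (rule nn_integral_cong_AE)
    show "AE y in \<nu>. ennreal (real_of_ereal (\<phi> y) - l y) = e2ennreal (\<phi> y - ereal (l y))"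
      using convex_L1_real(1)[OF L1]
    proof eventually_elim
      case (elim y)
      then show ?case by (cases "\<phi> y") auto
    qed
  qed
  also note c(1)
  finally have "(\<integral>y. real_of_ereal (\<phi> y) - l y \<partial>\<nu>) \<le> c"
    using c(2) by (simp add: ennreal_le_iff)
  then show "(\<integral>y. real_of_ereal (\<phi> y) \<partial>\<nu>) \<le> c + (\<integral>y. l y \<partial>\<nu>)"
    using convex_L1_real(2)[OF L1] l by simp
qed

context admissible_cost
begin

text \<open>Once \<open>x0\<close> is located, \<open>h\<close> bounds \<psi> from above on the unit
  ball around it; together with the lower bound at \<open>x0\<close>, convexity limits the descent
  in every direction. The constants precede \<psi> and \<open>x0\<close>, so they depend on
  \<open>m\<close>, \<open>K\<close> and \<open>h\<close> only.\<close>

lemma uniform_linear_lower_bound: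
  obtains \<kappa> \<alpha> where "0 < \<kappa>" "0 < \<alpha>"
    "\<And>\<psi> x0 x. convex_on UNIV \<psi> \<Longrightarrow> (\<And>x. \<psi> x \<le> h (x - m)) \<Longrightarrow> 2 * h (x0 - m) - \<psi> x0 \<le> K \<Longrightarrow>
       - \<kappa> * norm x - \<alpha> \<le> \<psi> x"
proof -
  obtain \<delta> C where \<delta>: "0 < \<delta>" "0 \<le> C" "\<And>z. \<delta> * norm z - C \<le> h z" using h_coercive by blast
  \<comment> \<open>The radius obtained from
    \<open>\<delta> * norm (x0 - m) - C \<le> h (x0 - m)\<close> and
    \<open>h (x0 - m) \<le> \<bar>K\<bar>\<close>.\<close>
  define R where "R = (\<bar>K\<bar> + C) / \<delta>"
  have "0 \<le> R" using \<delta> by (simp add: R_def)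
  have "bounded (h ` cball 0 (R + 1))"
    by (intro compact_imp_bounded compact_continuous_image continuous_on_subset[OF h_continuous]) auto
  then obtain M where "0 < M" and M: "\<forall>x\<in>cball 0 (R + 1). \<bar>h x\<bar> \<le> M"
    by (auto simp: bounded_pos)
  \<comment> \<open>The slope: \<open>\<bar>K\<bar>\<close> comes from the value at
    \<open>x0\<close>, \<open>M\<close> from the upper bound on the unit ball around it.\<close>
  define L where "L = \<bar>K\<bar> + M"
  have L: "0 < L" using \<open>0 < M\<close> by (simp add: L_def)
  show thesis
  proof (rule that)
    show "0 < L" by fact
    show "0 < L * (norm m + R) + \<bar>K\<bar> + 1" using L \<open>0 \<le> R\<close> by (simp add: add_nonneg_pos)
    fix \<psi> :: "'a \<Rightarrow> real" and x0 x
    assume \<psi>: "convex_on UNIV \<psi>" "\<And>x. \<psi> x \<le> h (x - m)" and x0: "2 * h (x0 - m) - \<psi> x0 \<le> K"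
    have "h (x0 - m) \<le> \<bar>K\<bar>" and low: "- \<bar>K\<bar> \<le> \<psi> x0"
      using x0 \<psi>(2)[of x0] h_nonneg[of "x0 - m"] by linarith+
    with \<delta>(3)[of "x0 - m"] have "norm (x0 - m) \<le> R"
      using \<delta>(1) by (simp add: R_def le_divide_eq mult.commute)
    have "\<psi> (x0 + u) \<le> M" if "norm u \<le> 1" for u
    proof -
      have "norm ((x0 - m) + u) \<le> R + 1"
        using that \<open>norm (x0 - m) \<le> R\<close> by (intro norm_triangle_mono) auto
      then have "\<bar>h ((x0 - m) + u)\<bar> \<le> M" using M by simp
      with \<psi>(2)[of "x0 + u"] show ?thesis by (simp add: algebra_simps)
    qed
    from convex_on_linear_lower_bound[OF \<psi>(1) this, of "x - x0"]
    have "(1 + norm (x - x0)) * \<psi> x0 - norm (x - x0) * M \<le> \<psi> x" by simp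
    moreover have "(1 + norm (x - x0)) * (- \<bar>K\<bar>) \<le> (1 + norm (x - x0)) * \<psi> x0"
      using low by (intro mult_left_mono) auto
    moreover have "(1 + norm (x - x0)) * (- \<bar>K\<bar>) - norm (x - x0) * M = - (L * norm (x - x0)) - \<bar>K\<bar>"
      by (simp add: L_def algebra_simps)
    moreover have "L * norm (x - x0) \<le> L * (norm x + (norm m + R))"
    proof (rule mult_left_mono)
      have "norm (x - x0) \<le> norm x + norm (m + (x0 - m))"
        using norm_triangle_ineq4[of x x0] by simp
      also have "norm (m + (x0 - m)) \<le> norm m + R"
        using \<open>norm (x0 - m) \<le> R\<close> by (intro norm_triangle_mono) auto
      finally show "norm (x - x0) \<le> norm x + (norm m + R)" by simp
    qed (use L in simp)
    moreover have "L * (norm x + (norm m + R)) = L * norm x + L * (norm m + R)"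
      by (simp add: distrib_left)
    ultimately show "- L * norm x - (L * (norm m + R) + \<bar>K\<bar> + 1) \<le> \<psi> x"
      by linarith
  qed
qed

end

section \<open>The dual functionals: finiteness, comparison, normalisation\<close>

locale dual_pair = admissible_cost p h for p and h :: "'a::euclidean_space \<Rightarrow> real" +
  fixes \<mu> \<nu> :: "'a measure"
  assumes \<mu>: "\<mu> \<in> P_space p" and \<nu>: "\<nu> \<in> P_space p"
begin

sublocale \<mu>: prob_space \<mu> using \<mu> by (simp add: P_space_def)
sublocale \<nu>: prob_space \<nu> using \<nu> by (simp add: P_space_def)

abbreviation "\<A> \<equiv> convex_class \<inter> C_bp p :: ('a \<Rightarrow> real) set"
abbreviation "B \<equiv> backward_functional (cost h) \<mu> \<nu>"
abbreviation "F \<equiv> forward_functional (cost h) \<mu> \<nu>"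
abbreviation "D \<equiv> backward_dual p (cost h) \<mu> \<nu>"
abbreviation "m \<equiv> mean \<nu>"

lemma conv_classD:
  assumes "f \<in> \<A>"
  shows "convex_on UNIV f" "f \<in> C_bp p" "integrable \<mu> f" "integrable \<nu> f" "continuous_on UNIV f"
  using assms C_bp_integrable[OF \<mu>] C_bp_integrable[OF \<nu>] by (auto simp: convex_class_def C_bp_iff)

lemma conv_class_convex_L1: "f \<in> \<A> \<Longrightarrow> (\<lambda>x. ereal (f x)) \<in> convex_L1 \<nu>"
  by (intro convex_L1_ereal conv_classD)

lemma convex_L1_finite_point:
  assumes "\<phi> \<in> convex_L1 \<nu>"
  obtains y r where "\<phi> y = ereal r"
proof -
  have "\<not> (AE x in \<nu>. False)" by (simp add: \<nu>.AE_False)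
  then have "\<exists>y. \<phi> y = ereal (real_of_ereal (\<phi> y))"
    using convex_L1_real(1)[OF assms] by (metis (mono_tags, lifting) eventually_mono)
  then show thesis using that by blast
qed

lemma backward_eq:
  assumes "\<phi> \<in> convex_L1 \<nu>" "u \<in> \<A>" "Q_c (cost h) \<phi> = (\<lambda>x. ereal (u x))"
  shows "B \<phi> = ereal ((\<integral>x. u x \<partial>\<mu>) - (\<integral>y. real_of_ereal (\<phi> y) \<partial>\<nu>))"
  using assms by (simp add: backward_functional_def convex_L1_real(3) ext_integral_real conv_classD)

lemma backward_cases:
  assumes \<phi>: "\<phi> \<in> convex_L1 \<nu>"
  obtains "B \<phi> = -\<infinity>"
  | u where "u \<in> \<A>" "Q_c (cost h) \<phi> = (\<lambda>x. ereal (u x))"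
proof -
  obtain y r where "\<phi> y = ereal r" using convex_L1_finite_point[OF \<phi>] .
  moreover have "ext_convex \<phi>" using \<phi> by (simp add: convex_L1_iff)
  ultimately consider "Q_c (cost h) \<phi> = (\<lambda>_. -\<infinity>)"
    | u where "u \<in> \<A>" "Q_c (cost h) \<phi> = (\<lambda>x. ereal (u x))"
    using Q_c_cases[of \<phi> y] by auto
  then show thesis
  proof cases
    case 1
    have "ext_integral \<mu> (\<lambda>_. -\<infinity>) = -\<infinity>"
      by (simp add: ext_integral_def \<mu>.emeasure_space_1 e2ennreal_neg zero_ennreal.rep_eq)
    with 1 have "B \<phi> = -\<infinity>"
      by (simp add: backward_functional_def convex_L1_real(3)[OF \<phi>])
    then show ?thesis by (rule that)
  qed (rule that)
qed

lemma Q_cbar_measurable: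
  assumes "f \<in> \<A>"
  shows "Q_cbar (cost h) (\<lambda>x. ereal (f x)) \<in> borel_measurable \<nu>"
proof -
  have [measurable_cong]: "sets \<nu> = sets borel" using \<nu> by (simp add: P_space_def)
  show ?thesis using Q_cbar_borel[OF conv_classD(5)[OF assms]] by measurable
qed

lemma Q_cbar_lower: "ereal (f y - h 0) \<le> Q_cbar (cost h) (\<lambda>x. ereal (f x)) y"
  using Q_cbar_ge[of "\<lambda>x. ereal (f x)" y "cost h" y] by (simp add: cost_def)

text \<open>The choice \<open>x = y\<close> in the supremum gives the integrable minorant
  \<open>f y - h 0\<close>, so finiteness of the positive part is the whole question.\<close>

lemma Q_cbar_convex_L1:
  assumes f: "f \<in> \<A>" and fin: "(\<integral>\<^sup>+y. e2ennreal (Q_cbar (cost h) (\<lambda>x. ereal (f x)) y) \<partial>\<nu>) < \<infinity>"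
  shows "Q_cbar (cost h) (\<lambda>x. ereal (f x)) \<in> convex_L1 \<nu>" (is "?\<phi> \<in> _")
proof -
  note [measurable] = Q_cbar_measurable[OF f]
  have l: "integrable \<nu> (\<lambda>y. f y - h 0)" using conv_classD(4)[OF f] by simp
  then have [measurable]: "(\<lambda>y. f y - h 0) \<in> borel_measurable \<nu>" by auto
  have "(\<integral>\<^sup>+y. e2ennreal \<bar>?\<phi> y\<bar> \<partial>\<nu>) \<le> (\<integral>\<^sup>+y. e2ennreal (?\<phi> y) + ennreal \<bar>f y - h 0\<bar> \<partial>\<nu>)"
  proof (rule nn_integral_mono)
    fix y
    show "e2ennreal \<bar>?\<phi> y\<bar> \<le> e2ennreal (?\<phi> y) + ennreal \<bar>f y - h 0\<bar>"
    proof (cases "?\<phi> y")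
      case (real r)
      then have "f y - h 0 \<le> r" using Q_cbar_lower[of f y] by simp
      then show ?thesis
        by (cases "0 \<le> r") (auto simp: real ennreal_neg add_increasing2 simp flip: ennreal_plus)
    next
      case MInf
      then show ?thesis using Q_cbar_lower[of f y] by simp
    qed simp
  qed
  also have "\<dots> = (\<integral>\<^sup>+y. e2ennreal (?\<phi> y) \<partial>\<nu>) + (\<integral>\<^sup>+y. ennreal \<bar>f y - h 0\<bar> \<partial>\<nu>)"
    by (rule nn_integral_add) auto
  also have "\<dots> < \<infinity>"
    using fin l by (auto simp: integrable_iff_bounded)
  finally show ?thesis
    using Q_cbar_measurable[OF f] Q_cbar_ext_convex[OF conv_classD(1)[OF f]] by (simp add: convex_L1_iff)
qed

lemma forward_eq:
  assumes "f \<in> \<A>" "Q_cbar (cost h) (\<lambda>x. ereal (f x)) \<in> convex_L1 \<nu>"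
  shows "F (\<lambda>x. ereal (f x)) =
    ereal ((\<integral>x. f x \<partial>\<mu>) - (\<integral>y. real_of_ereal (Q_cbar (cost h) (\<lambda>x. ereal (f x)) y) \<partial>\<nu>))"
  using assms by (simp add: forward_functional_def convex_L1_real(3) ext_integral_real conv_classD)

text \<open>The minorant \<open>f y - h 0\<close> keeps the negative part integrable; an infinite
  positive part then makes the integral \<infinity> and not a difference of infinities.\<close>

lemma forward_cases:
  assumes f: "f \<in> \<A>"
  obtains "F (\<lambda>x. ereal (f x)) = -\<infinity>" | "Q_cbar (cost h) (\<lambda>x. ereal (f x)) \<in> convex_L1 \<nu>"
proof (cases "(\<integral>\<^sup>+y. e2ennreal (Q_cbar (cost h) (\<lambda>x. ereal (f x)) y) \<partial>\<nu>) < \<infinity>")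
  case True
  with Q_cbar_convex_L1[OF f] that(2) show thesis by blast
next
  case False
  let ?\<phi> = "Q_cbar (cost h) (\<lambda>x. ereal (f x))"
  have l: "integrable \<nu> (\<lambda>y. f y - h 0)" using conv_classD(4)[OF f] by simp
  have "(\<integral>\<^sup>+y. e2ennreal (- ?\<phi> y) \<partial>\<nu>) \<le> (\<integral>\<^sup>+y. ennreal \<bar>f y - h 0\<bar> \<partial>\<nu>)"
  proof (rule nn_integral_mono)
    fix y
    show "e2ennreal (- ?\<phi> y) \<le> ennreal \<bar>f y - h 0\<bar>"
      using Q_cbar_lower[of f y] by (cases "?\<phi> y") (auto intro!: ennreal_leI simp: e2ennreal_neg)
  qed
  also have "\<dots> < \<infinity>"
    using l by (simp add: integrable_iff_bounded)
  finally have "(\<integral>\<^sup>+y. e2ennreal (- ?\<phi> y) \<partial>\<nu>) < \<infinity>" .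
  moreover have "(\<integral>\<^sup>+y. e2ennreal (?\<phi> y) \<partial>\<nu>) = \<top>"
    using False by (simp add: less_top[symmetric])
  ultimately have "ext_integral \<nu> ?\<phi> = \<infinity>"
    by (cases "\<integral>\<^sup>+y. e2ennreal (- ?\<phi> y) \<partial>\<nu>")
       (auto simp: ext_integral_def enn2ereal_ennreal)
  then have "F (\<lambda>x. ereal (f x)) = -\<infinity>"
    by (simp add: forward_functional_def ext_integral_real conv_classD[OF f])
  then show thesis by (rule that)
qed

text \<open>\<open>Q_cbar_Q_c_le\<close> is used twice: for the integrability of the new function,
  then for the comparison of the integrals.\<close>

lemma backward_le_forward:
  assumes \<phi>: "\<phi> \<in> convex_L1 \<nu>" and u: "u \<in> \<A>" "Q_c (cost h) \<phi> = (\<lambda>x. ereal (u x))"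
  shows "B \<phi> \<le> F (\<lambda>x. ereal (u x))"
proof -
  let ?\<phi>' = "Q_cbar (cost h) (\<lambda>x. ereal (u x))"
  have le: "?\<phi>' y \<le> \<phi> y" for y by (rule Q_cbar_Q_c_le[OF u(2)])
  have "(\<integral>\<^sup>+y. e2ennreal (?\<phi>' y) \<partial>\<nu>) \<le> (\<integral>\<^sup>+y. e2ennreal \<bar>\<phi> y\<bar> \<partial>\<nu>)"
  proof (intro nn_integral_mono e2ennreal_mono order_trans[OF le])
    show "\<phi> y \<le> \<bar>\<phi> y\<bar>" for y by (cases "\<phi> y") auto
  qed
  also have "\<dots> < \<infinity>" using \<phi> by (simp add: convex_L1_iff)
  finally have L1: "?\<phi>' \<in> convex_L1 \<nu>" by (rule Q_cbar_convex_L1[OF u(1)])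
  have "(\<integral>y. real_of_ereal (?\<phi>' y) \<partial>\<nu>) \<le> (\<integral>y. real_of_ereal (\<phi> y) \<partial>\<nu>)"
  proof (rule integral_mono_AE)
    show "AE y in \<nu>. real_of_ereal (?\<phi>' y) \<le> real_of_ereal (\<phi> y)"
      using convex_L1_real(1)[OF L1] convex_L1_real(1)[OF \<phi>]
    proof eventually_elim
      case (elim y)
      with le[of y] show ?case by (metis ereal_less_eq(3))
    qed
  qed (intro convex_L1_real L1 \<phi>)+
  then show ?thesis
    by (simp add: backward_eq[OF \<phi> u] forward_eq[OF u(1) L1])
qed

text \<open>The comparison is with the value at a member of \<open>convex_L1 \<nu>\<close>, which
  need not belong to the class defining \<open>D\<close>; the bound by \<open>D\<close> itself is a
  separate matter.\<close>

lemma forward_le_backward: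
  assumes f: "f \<in> \<A>" and L1: "Q_cbar (cost h) (\<lambda>x. ereal (f x)) \<in> convex_L1 \<nu>" (is "?\<phi> \<in> _")
  shows "F (\<lambda>x. ereal (f x)) \<le> B ?\<phi>"
    and "\<exists>u\<in>\<A>. Q_c (cost h) ?\<phi> = (\<lambda>x. ereal (u x))"
proof -
  have ge: "ereal (f x) \<le> Q_c (cost h) ?\<phi> x" for x by (rule Q_c_Q_cbar_ge)
  obtain y r where "?\<phi> y = ereal r" using convex_L1_finite_point[OF L1] .
  moreover have "ext_convex ?\<phi>" using L1 by (simp add: convex_L1_iff)
  moreover have "Q_c (cost h) ?\<phi> \<noteq> (\<lambda>_. -\<infinity>)"
    using ge[of 0] by auto
  ultimately obtain u where u: "u \<in> \<A>" "Q_c (cost h) ?\<phi> = (\<lambda>x. ereal (u x))"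
    using Q_c_cases[of ?\<phi> y] by auto
  then show "\<exists>u\<in>\<A>. Q_c (cost h) ?\<phi> = (\<lambda>x. ereal (u x))" by blast
  have "(\<integral>x. f x \<partial>\<mu>) \<le> (\<integral>x. u x \<partial>\<mu>)"
    using ge u(2) by (intro integral_mono conv_classD f u) auto
  then show "F (\<lambda>x. ereal (f x)) \<le> B ?\<phi>"
    by (simp add: backward_eq[OF L1 u] forward_eq[OF f L1])
qed

lemma cost_integrable: "integrable \<mu> (\<lambda>x. h (x - y))"
  by (rule C_bp_integrable[OF \<mu> cost_C_bp])

lemma backward_dual_nonneg: "0 \<le> D"
proof -
  have zero: "(\<lambda>_. 0) \<in> \<A>"
    by (auto simp: convex_class_def C_bp_const convex_on_const)
  have ge: "0 \<le> Q_c (cost h) (\<lambda>_. ereal 0) x" for x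
    unfolding Q_c_def by (rule INF_greatest) (simp add: cost_def h_nonneg)
  have "Q_c (cost h) (\<lambda>_. ereal 0) \<noteq> (\<lambda>_. -\<infinity>)"
    using ge[of 0] by auto
  moreover have "ext_convex (\<lambda>_::'a. ereal 0)" by (rule ext_convex_ereal) (rule conv_classD[OF zero])
  ultimately obtain u where u: "u \<in> \<A>" "Q_c (cost h) (\<lambda>_. ereal 0) = (\<lambda>x. ereal (u x))"
    using Q_c_cases[of "\<lambda>_. ereal 0"] by auto
  then have "0 \<le> (\<integral>x. u x \<partial>\<mu>)"
    using ge by (intro Bochner_Integration.integral_nonneg) auto
  then have "0 \<le> B (\<lambda>_. ereal 0)"
    by (simp add: backward_eq[OF conv_class_convex_L1[OF zero] u])
  also have "\<dots> \<le> D" unfolding backward_dual_def using zero by (rule SUP_upper)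
  finally show ?thesis .
qed

lemma conv_class_diff_const: "f \<in> \<A> \<Longrightarrow> (\<lambda>x. f x - c) \<in> \<A>"
  using convex_on_add[of UNIV f "\<lambda>_. - c"] C_bp_diff[OF _ C_bp_const]
  by (auto simp: convex_class_def convex_on_const)

text \<open>Subtracting \<open>f m\<close> shifts both integrals equally, as both measures have mass
  one, and Jensen's inequality then makes the integral of \<open>g\<close> nonnegative. The
  transform is remembered only through \<open>w x \<le> g y + h (x - y)\<close>, which is stable
  under limits inferior.\<close>

lemma backward_normalized:
  assumes f: "f \<in> \<A>" and fin: "B (\<lambda>x. ereal (f x)) \<noteq> -\<infinity>"
  obtains w g where "w \<in> \<A>" "g \<in> \<A>" "\<And>x y. w x \<le> g y + h (x - y)"
    "\<And>x. w x \<le> h (x - m)" "0 \<le> (\<integral>y. g y \<partial>\<nu>)"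
    "B (\<lambda>x. ereal (f x)) = ereal ((\<integral>x. w x \<partial>\<mu>) - (\<integral>y. g y \<partial>\<nu>))"
proof -
  obtain u where u: "u \<in> \<A>" "Q_c (cost h) (\<lambda>x. ereal (f x)) = (\<lambda>x. ereal (u x))"
    using backward_cases[OF conv_class_convex_L1[OF f]] fin by metis
  have le: "u x \<le> f y + h (x - y)" for x y
    using Q_c_le[of "cost h" "\<lambda>x. ereal (f x)" x y] by (simp add: u cost_def)
  show thesis
  proof (rule that[of "\<lambda>x. u x - f m" "\<lambda>y. f y - f m"])
    show "(\<lambda>x. u x - f m) \<in> \<A>" "(\<lambda>y. f y - f m) \<in> \<A>"
      by (intro conv_class_diff_const u f)+
    show "u x - f m \<le> f y - f m + h (x - y)" "u x - f m \<le> h (x - m)" for x y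
      using le[of x y] le[of x m] by auto
    show "0 \<le> (\<integral>y. f y - f m \<partial>\<nu>)"
      using jensen_convex_L1[OF p \<nu> conv_class_convex_L1[OF f]] conv_classD[OF f] by (simp add: \<nu>.prob_space)
    show "B (\<lambda>x. ereal (f x)) = ereal ((\<integral>x. u x - f m \<partial>\<mu>) - (\<integral>y. f y - f m \<partial>\<nu>))"
      using conv_classD[OF f] conv_classD[OF u(1)]
      by (simp add: backward_eq[OF conv_class_convex_L1[OF f] u] \<nu>.prob_space \<mu>.prob_space)
  qed
qed

lemma backward_dual_le: "D \<le> ereal (\<integral>x. h (x - m) \<partial>\<mu>)"
  unfolding backward_dual_def
proof (rule SUP_least)
  fix f assume f: "f \<in> \<A>"
  show "B (\<lambda>x. ereal (f x)) \<le> ereal (\<integral>x. h (x - m) \<partial>\<mu>)"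
  proof (cases "B (\<lambda>x. ereal (f x)) = -\<infinity>")
    case False
    obtain w g where w: "w \<in> \<A>" "\<And>x. w x \<le> h (x - m)" "0 \<le> (\<integral>y. g y \<partial>\<nu>)"
      "B (\<lambda>x. ereal (f x)) = ereal ((\<integral>x. w x \<partial>\<mu>) - (\<integral>y. g y \<partial>\<nu>))"
      using backward_normalized[OF f False] by metis
    have "(\<integral>x. w x \<partial>\<mu>) \<le> (\<integral>x. h (x - m) \<partial>\<mu>)"
      by (intro integral_mono conv_classD w cost_integrable)
    with w show ?thesis by simp
  qed simp
qed

lemma backward_dual_real:
  obtains d where "D = ereal d" "0 \<le> d"
  using backward_dual_nonneg backward_dual_le by (cases D) auto

text \<open>Otherwise integration against \<mu> would give \<open>2 * b + 2 \<le> 2 * b + 1\<close>.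
  The slack 1 admits the members of a maximizing sequence besides exact optimizers.\<close>

lemma exists_small_gap:
  assumes "\<psi> \<in> \<A>" "-1 \<le> (\<integral>x. \<psi> x \<partial>\<mu>)" "(\<integral>x. h (x - m) \<partial>\<mu>) \<le> b"
  shows "\<exists>x0. 2 * h (x0 - m) - \<psi> x0 \<le> 2 * b + 2"
proof (rule ccontr)
  assume "\<not> ?thesis"
  then have *: "2 * b + 2 \<le> 2 * h (x - m) - \<psi> x" for x by (metis linear)
  have "2 * b + 2 \<le> (\<integral>x. 2 * h (x - m) - \<psi> x \<partial>\<mu>)"
    using * cost_integrable conv_classD[OF assms(1)] by (intro \<mu>.integral_ge_const) auto
  also have "\<dots> = 2 * (\<integral>x. h (x - m) \<partial>\<mu>) - (\<integral>x. \<psi> x \<partial>\<mu>)"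
    using cost_integrable conv_classD[OF assms(1)] by simp
  finally show False using assms by linarith
qed

end

section \<open>Truncation of \<open>Q_cbar\<close> to shifts of bounded length\<close>

context admissible_cost
begin

text \<open>The ball bounds the shift \<open>z = x - y\<close> and not the point \<open>x\<close>:
  for fixed \<open>z\<close> the cost is constant in \<open>y\<close>, so convexity is inherited
  from \<open>f\<close>.\<close>

definition Q_cbar_trunc :: "nat \<Rightarrow> ('a \<Rightarrow> real) \<Rightarrow> 'a \<Rightarrow> real" where
  "Q_cbar_trunc n f y = (SUP z\<in>cball 0 (real n). f (y + z) - h z)"

lemma Q_cbar_trunc_upper:
  assumes f: "continuous_on UNIV f" and z: "norm z \<le> real n"
  shows "f (y + z) - h z \<le> Q_cbar_trunc n f y"
  unfolding Q_cbar_trunc_def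
proof (rule cSUP_upper)
  have "continuous_on (cball 0 (real n)) (\<lambda>z. f (y + z) - h z)"
    by (intro continuous_intros continuous_on_compose2[OF f] continuous_on_subset[OF h_continuous]) auto
  then have "bounded ((\<lambda>z. f (y + z) - h z) ` cball 0 (real n))"
    by (intro compact_imp_bounded compact_continuous_image) auto
  then show "bdd_above ((\<lambda>z. f (y + z) - h z) ` cball 0 (real n))"
    by (rule bounded_imp_bdd_above)
qed (use z in simp)

lemma Q_cbar_trunc_least:
  "(\<And>z. norm z \<le> real n \<Longrightarrow> f (y + z) - h z \<le> c) \<Longrightarrow> Q_cbar_trunc n f y \<le> c"
  unfolding Q_cbar_trunc_def by (rule cSUP_least) auto

lemma Q_cbar_trunc_mono:
  assumes "continuous_on UNIV f" "n \<le> n'"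
  shows "Q_cbar_trunc n f y \<le> Q_cbar_trunc n' f y"
  by (rule Q_cbar_trunc_least, rule Q_cbar_trunc_upper) (use assms in auto)

lemma Q_cbar_trunc_le:
  assumes "Q_cbar (cost h) (\<lambda>x. ereal (f x)) y = ereal r"
  shows "Q_cbar_trunc n f y \<le> r"
proof (rule Q_cbar_trunc_least)
  fix z show "f (y + z) - h z \<le> r"
    using Q_cbar_ge[of "\<lambda>x. ereal (f x)" "y + z" "cost h" y] assms by (simp add: cost_def)
qed

lemma Q_cbar_trunc_convex:
  assumes f: "convex_on UNIV f"
  shows "convex_on UNIV (Q_cbar_trunc n f)"
proof (rule convex_onI)
  fix t :: real and x y :: 'a assume t: "0 < t" "t < 1"
  show "Q_cbar_trunc n f ((1 - t) *\<^sub>R x + t *\<^sub>R y) \<le> (1 - t) * Q_cbar_trunc n f x + t * Q_cbar_trunc n f y"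
  proof (rule Q_cbar_trunc_least)
    fix z :: 'a assume z: "norm z \<le> real n"
    have "(1 - t) *\<^sub>R x + t *\<^sub>R y + z = (1 - t) *\<^sub>R (x + z) + t *\<^sub>R (y + z)"
      by (simp add: algebra_simps)
    then have "f ((1 - t) *\<^sub>R x + t *\<^sub>R y + z) \<le> (1 - t) * f (x + z) + t * f (y + z)"
      using convex_onD[OF f, of t "x + z" "y + z"] t by simp
    then have "f ((1 - t) *\<^sub>R x + t *\<^sub>R y + z) - h z \<le> (1 - t) * (f (x + z) - h z) + t * (f (y + z) - h z)"
      by (simp add: algebra_simps)
    also have "\<dots> \<le> (1 - t) * Q_cbar_trunc n f x + t * Q_cbar_trunc n f y"
      using t z by (intro add_mono mult_left_mono Q_cbar_trunc_upper convex_on_UNIV_continuous f) auto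
    finally show "f ((1 - t) *\<^sub>R x + t *\<^sub>R y + z) - h z \<le> \<dots>" .
  qed
qed simp

lemma Q_cbar_trunc_C_bp:
  assumes f: "convex_on UNIV f" "f \<in> C_bp p"
  shows "Q_cbar_trunc n f \<in> C_bp p"
proof -
  obtain K where K: "0 \<le> K" "\<And>x. \<bar>f x\<bar> \<le> K * (1 + norm x powr p)"
    using f(2) by (auto simp: C_bp_iff)
  show ?thesis
  proof (rule convex_growth_C_bp[OF p Q_cbar_trunc_convex[OF f(1)]])
    show "0 \<le> K * (2 powr p * (1 + real n powr p))" using K by simp
    fix y :: 'a
    show "Q_cbar_trunc n f y \<le> K * (2 powr p * (1 + real n powr p)) * (1 + norm y powr p)"
    proof (rule Q_cbar_trunc_least)
      fix z :: 'a assume z: "norm z \<le> real n"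
      have "f (y + z) - h z \<le> K * (1 + norm (y + z) powr p)"
        using K(2)[of "y + z"] h_nonneg[of z] by linarith
      also have "\<dots> \<le> K * (2 powr p * (1 + norm z powr p) * (1 + norm y powr p))"
        by (intro mult_left_mono one_plus_powr_norm_add_le p K)
      also have "\<dots> \<le> K * (2 powr p * (1 + real n powr p) * (1 + norm y powr p))"
        using K z p by (intro mult_left_mono mult_right_mono add_left_mono powr_mono2) auto
      finally show "f (y + z) - h z \<le> K * (2 powr p * (1 + real n powr p)) * (1 + norm y powr p)"
        by (simp add: mult.assoc)
    qed
  qed
qed

text \<open>Inside the ball of radius \<open>n\<close> about \<open>x\<close> the truncation is harmless. Outside it, convexity
  along the segment from \<open>y0\<close> lets \<open>Q_cbar_trunc n f y + h (x - y)\<close> fall below \<open>f x\<close> by at most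
  a multiple of \<open>norm (x - y) / n\<close>; the factor \<open>1 - e\<close> leaves the summand \<open>e * h (x - y)\<close>,
  which grows linearly and absorbs this.\<close>

lemma Q_cbar_trunc_eventually_ge:
  assumes f: "convex_on UNIV f" and y0: "Q_cbar (cost h) (\<lambda>x. ereal (f x)) y0 = ereal r"
    and e: "0 < e" "e < 1"
  shows "\<exists>N. \<forall>n\<ge>N. \<forall>y. (1 - e) * f x \<le> (1 - e) * Q_cbar_trunc n f y + h (x - y)"
proof -
  note cont = convex_on_UNIV_continuous[OF f]
  obtain \<delta> C where \<delta>: "0 < \<delta>" "0 \<le> C" "\<And>z. \<delta> * norm z - C \<le> h z" using h_coercive by blast
  \<comment> \<open>The bound for \<open>f x\<close> that \<open>y0\<close> alone provides;
    \<open>A - f x\<close> measures what convexity from \<open>y0\<close> can lose.\<close>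
  define A where "A = r + h (x - y0)"
  define \<rho> where "\<rho> = norm (x - y0)"
  have A: "f x \<le> A"
    using Q_cbar_ge[of "\<lambda>x. ereal (f x)" x "cost h" y0] y0 by (simp add: cost_def A_def)
  \<comment> \<open>The first two terms make \<open>real n - \<rho>\<close> at least 1. The third
    lets half of the growth \<open>e * \<delta> * q\<close> pay for the loss along the segment, the
    fourth lets the other half pay for \<open>e * C\<close>.\<close>
  obtain N :: nat where N: "\<rho> + 1 + 4 * (A - f x) / (e * \<delta>) + 2 * C / \<delta> \<le> real N"
    using real_arch_simple by blast
  have "(1 - e) * f x \<le> (1 - e) * Q_cbar_trunc n f y + h (x - y)" if "N \<le> n" for n y
  proof -
    let ?Q = "Q_cbar_trunc n f"
    define q where "q = norm (x - y)"
    have frac: "0 \<le> 4 * (A - f x) / (e * \<delta>)" "0 \<le> 2 * C / \<delta>" "0 \<le> \<rho>"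
      using A e \<delta> by (auto simp: \<rho>_def)
    have "\<rho> + 1 + 4 * (A - f x) / (e * \<delta>) + 2 * C / \<delta> \<le> real n"
      using N that by linarith
    then have n: "\<rho> + 1 \<le> real n" "4 * (A - f x) / (e * \<delta>) \<le> real n - \<rho>" "2 * C / \<delta> \<le> real n"
      using frac by linarith+
    have near: "f x \<le> ?Q y + h (x - y)" if "norm (x - y) \<le> real n" for y
      using Q_cbar_trunc_upper[OF cont that, of y] by simp
    show ?thesis
    proof (cases "q \<le> real n")
      case True
      have "(1 - e) * f x \<le> (1 - e) * (?Q y + h (x - y))"
        using e True near[of y] by (intro mult_left_mono) (auto simp: q_def)
      also have "\<dots> \<le> (1 - e) * ?Q y + h (x - y)"
        using e h_nonneg[of "x - y"] by (simp add: algebra_simps)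
      finally show ?thesis .
    next
      case False
      define L where "L = norm (y - y0)"
      have "q \<le> \<rho> + L"
        unfolding q_def \<rho>_def L_def using norm_triangle_ineq4[of "x - y0" "y - y0"] by simp
      moreover have "L \<le> \<rho> + q"
        unfolding q_def \<rho>_def L_def using norm_triangle_ineq4[of "x - y0" "x - y"] by simp
      ultimately have L: "real n - \<rho> \<le> L" "L \<le> 2 * q" "0 < L"
        using False n frac by linarith+
      \<comment> \<open>Places \<open>y'\<close> on the segment at distance
        \<open>real n - \<rho>\<close> from \<open>y0\<close>, hence within \<open>real n\<close> of
        \<open>x\<close>, where \<open>near\<close> applies.\<close>
      define s where "s = (real n - \<rho>) / L"
      have s: "0 \<le> s" "s \<le> 1" "s * L = real n - \<rho>"
        using L n by (auto simp: s_def)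
      define y' where "y' = (1 - s) *\<^sub>R y0 + s *\<^sub>R y"
      have eq: "x - y' = (x - y0) - s *\<^sub>R (y - y0)"
        by (simp add: y'_def algebra_simps)
      have "norm (x - y') \<le> \<rho> + s * L"
        unfolding eq using norm_triangle_ineq4[of "x - y0" "s *\<^sub>R (y - y0)"] s
        by (simp add: \<rho>_def L_def)
      then have "f x \<le> ?Q y' + h (x - y')"
        using s by (intro near) simp
      also have "?Q y' \<le> (1 - s) * ?Q y0 + s * ?Q y"
        unfolding y'_def using s by (intro convex_onD[OF Q_cbar_trunc_convex[OF f]]) auto
      also have "(1 - s) * ?Q y0 \<le> (1 - s) * r"
        using s by (intro mult_left_mono Q_cbar_trunc_le[OF y0]) auto
      also have "h (x - y') \<le> (1 - s) * h (x - y0) + s * h (x - y)"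
      proof -
        have "x - y' = (1 - s) *\<^sub>R (x - y0) + s *\<^sub>R (x - y)"
          by (simp add: y'_def algebra_simps)
        then show ?thesis
          using convex_onD[OF h_convex, of s "x - y0" "x - y"] s by simp
      qed
      finally have "f x \<le> (1 - s) * A + s * (?Q y + h (x - y))"
        by (simp add: A_def algebra_simps)
      then have *: "- ((1 - s) * (A - f x)) \<le> s * (?Q y + h (x - y) - f x)"
        by (simp add: algebra_simps)
      have "(1 - s) * (A - f x) \<le> 1 * (A - f x)"
        using s A by (intro mult_right_mono) auto
      then have "- (A - f x) \<le> - ((1 - s) * (A - f x))" by simp
      also note *
      finally have "- (A - f x) \<le> s * (?Q y + h (x - y) - f x)" .
      then have "L * (- (A - f x)) \<le> L * (s * (?Q y + h (x - y) - f x))"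
        using L by (intro mult_left_mono) auto
      also have "\<dots> = (real n - \<rho>) * (?Q y + h (x - y) - f x)"
        by (simp flip: s(3))
      finally have 1: "- (L * (A - f x)) \<le> (real n - \<rho>) * (?Q y + h (x - y) - f x)"
        unfolding mult_minus_right .
      have "L * (A - f x) \<le> (2 * q) * (A - f x)"
        using L A by (intro mult_right_mono) auto
      also have "\<dots> = q / 2 * (4 * (A - f x))" by simp
      also have "\<dots> \<le> q / 2 * ((real n - \<rho>) * (e * \<delta>))"
        using n(2) e \<delta> L by (intro mult_left_mono) (auto simp: divide_le_eq)
      finally have "- (q / 2 * ((real n - \<rho>) * (e * \<delta>))) \<le> - (L * (A - f x))" by simp
      also note 1
      also have "- (q / 2 * ((real n - \<rho>) * (e * \<delta>))) = (real n - \<rho>) * (- (q / 2 * (e * \<delta>)))"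
        by simp
      finally have "(real n - \<rho>) * (- (q / 2 * (e * \<delta>))) \<le> (real n - \<rho>) * (?Q y + h (x - y) - f x)" .
      then have "- (q / 2 * (e * \<delta>)) \<le> ?Q y + h (x - y) - f x"
        by (rule mult_left_le_imp_le) (use n in simp)
      then have 2: "f x - q / 2 * (e * \<delta>) \<le> ?Q y + h (x - y)" by linarith
      have "(1 - e) * f x \<le> (1 - e) * (f x - q / 2 * (e * \<delta>)) + e * (\<delta> * q - C)"
      proof -
        have "2 * C \<le> q * \<delta>"
          using n(3) False \<delta> by (simp add: divide_le_eq) (smt (verit) mult_right_mono)
        \<comment> \<open>The right-hand side of the claim minus its left-hand side.\<close>
        then have "0 \<le> e * (q * \<delta> / 2 - C) + e * e * (q * \<delta> / 2)"
          using e \<delta> L by (intro add_nonneg_nonneg mult_nonneg_nonneg) auto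
        then show ?thesis by (simp add: algebra_simps add_divide_distrib diff_divide_distrib)
      qed
      also have "\<dots> \<le> (1 - e) * (?Q y + h (x - y)) + e * h (x - y)"
        using e 2 \<delta>(3)[of "x - y"] by (intro add_mono mult_left_mono) (auto simp: q_def)
      also have "\<dots> = (1 - e) * ?Q y + h (x - y)" by (simp add: algebra_simps)
      finally show ?thesis .
    qed
  qed
  then show ?thesis by blast
qed

end

section \<open>Forward values stay below the backward dual\<close>

context dual_pair
begin

text \<open>The truncation threshold depends on \<open>x\<close>, so on the \<mu> side convergence
  is only pointwise and domination is required. On the \<nu> side the truncation lies below
  \<open>Q_cbar\<close>, and a mere comparison suffices.\<close>

lemma forward_scaled_le_backward_dual:
  assumes f: "f \<in> \<A>" and L1: "Q_cbar (cost h) (\<lambda>x. ereal (f x)) \<in> convex_L1 \<nu>" (is "?\<phi> \<in> _")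
    and e: "0 < e" "e < 1"
  shows "ereal ((1 - e) * ((\<integral>x. f x \<partial>\<mu>) - (\<integral>y. real_of_ereal (?\<phi> y) \<partial>\<nu>))) \<le> D"
proof -
  obtain y0 r where y0: "?\<phi> y0 = ereal r" using convex_L1_finite_point[OF L1] .
  have "\<exists>N. \<forall>n\<ge>N. \<forall>y. (1 - e) * f x \<le> (1 - e) * Q_cbar_trunc n f y + h (x - y)" for x
    by (rule Q_cbar_trunc_eventually_ge[OF conv_classD(1)[OF f] y0 e])
  then obtain N where N: "\<And>x n y. N x \<le> n \<Longrightarrow> (1 - e) * f x \<le> (1 - e) * Q_cbar_trunc n f y + h (x - y)"
    by metis
  define g where "g n y = (1 - e) * Q_cbar_trunc n f y" for n y
  have g: "g n \<in> \<A>" for n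
    using Q_cbar_trunc_convex[OF conv_classD(1)[OF f]] Q_cbar_trunc_C_bp[OF conv_classD(1,2)[OF f]] e
    unfolding g_def by (auto simp: convex_class_def intro!: convex_on_cmul C_bp_cmult)
  have Q: "ereal ((1 - e) * f x) \<le> Q_c (cost h) (\<lambda>y. ereal (g n y)) x" if "N x \<le> n" for n x
    unfolding Q_c_def using N[OF that] by (intro INF_greatest) (simp add: g_def cost_def)
  have "\<exists>u\<in>\<A>. Q_c (cost h) (\<lambda>y. ereal (g n y)) = (\<lambda>x. ereal (u x))" if "N 0 \<le> n" for n
  proof -
    have "Q_c (cost h) (\<lambda>y. ereal (g n y)) \<noteq> (\<lambda>_. -\<infinity>)"
      using Q[OF that] by auto
    then show ?thesis
      using Q_c_cases[OF ext_convex_ereal[OF conv_classD(1)[OF g[of n]]], of 0] by (metis PInfty_neq_ereal(1))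
  qed
  then obtain u where u: "\<And>n. N 0 \<le> n \<Longrightarrow> u n \<in> \<A>"
    "\<And>n. N 0 \<le> n \<Longrightarrow> Q_c (cost h) (\<lambda>y. ereal (g n y)) = (\<lambda>x. ereal (u n x))"
    by metis
  \<comment> \<open>From this index on the transforms are real: a lower bound at the single point 0
    rules out the first alternative of \<open>Q_c_cases\<close>.\<close>
  define n0 where "n0 = N 0"
  \<comment> \<open>The minimum bounds the sequence from above; monotonicity in the truncation index
    bounds it from below through \<open>u n0\<close>. At each \<open>x\<close> it eventually equals
    its limit.\<close>
  define v where "v n x = min (u (n0 + n) x) ((1 - e) * f x)" for n x
  have mono: "u n0 x \<le> u (n0 + n) x" for n x
  proof -
    have "Q_c (cost h) (\<lambda>y. ereal (g n0 y)) x \<le> Q_c (cost h) (\<lambda>y. ereal (g (n0 + n) y)) x"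
      unfolding Q_c_def g_def using e
      by (intro INF_mono' add_right_mono) (auto intro!: mult_left_mono Q_cbar_trunc_mono conv_classD f)
    then show ?thesis using u(2)[of n0] u(2)[of "n0 + n"] by (simp add: n0_def)
  qed
  have int_u: "integrable \<mu> (u (n0 + n))" for n
    using conv_classD[OF u(1)] by (simp add: n0_def)
  have int_u0: "integrable \<mu> (u n0)"
    using int_u[of 0] by simp
  have int_f: "integrable \<mu> f" using conv_classD[OF f] by simp
  have int_v: "integrable \<mu> (v n)" for n
    unfolding v_def using int_u int_f by (intro integrable_min) auto
  have "(\<lambda>n. \<integral>x. v n x \<partial>\<mu>) \<longlonglongrightarrow> (\<integral>x. (1 - e) * f x \<partial>\<mu>)"
  proof (rule integral_dominated_convergence)
    show "integrable \<mu> (\<lambda>x. \<bar>u n0 x\<bar> + \<bar>f x\<bar>)"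
      using int_u0 int_f by auto
    show "AE x in \<mu>. (\<lambda>n. v n x) \<longlonglongrightarrow> (1 - e) * f x"
    proof (intro AE_I2 tendsto_eventually eventually_sequentiallyI)
      fix x n assume "N x \<le> n"
      then have "(1 - e) * f x \<le> u (n0 + n) x"
        using Q[of x "n0 + n"] u(2)[of "n0 + n"] by (simp add: n0_def)
      then show "v n x = (1 - e) * f x" by (simp add: v_def)
    qed
    show "AE x in \<mu>. norm (v n x) \<le> \<bar>u n0 x\<bar> + \<bar>f x\<bar>" for n
    proof (rule AE_I2)
      fix x
      have "\<bar>(1 - e) * f x\<bar> \<le> 1 * \<bar>f x\<bar>"
        unfolding abs_mult using e by (intro mult_right_mono) auto
      with mono[of x n] show "norm (v n x) \<le> \<bar>u n0 x\<bar> + \<bar>f x\<bar>"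
        unfolding v_def real_norm_def by linarith
    qed
  qed (use int_f int_v in auto)
  then have lim: "(\<lambda>n. (\<integral>x. v n x \<partial>\<mu>) - (1 - e) * (\<integral>y. real_of_ereal (?\<phi> y) \<partial>\<nu>))
      \<longlonglongrightarrow> (\<integral>x. (1 - e) * f x \<partial>\<mu>) - (1 - e) * (\<integral>y. real_of_ereal (?\<phi> y) \<partial>\<nu>)"
    by (intro tendsto_intros)
  have le: "ereal ((\<integral>x. v n x \<partial>\<mu>) - (1 - e) * (\<integral>y. real_of_ereal (?\<phi> y) \<partial>\<nu>)) \<le> D" for n
  proof -
    have un: "u (n0 + n) \<in> \<A>" "Q_c (cost h) (\<lambda>y. ereal (g (n0 + n) y)) = (\<lambda>x. ereal (u (n0 + n) x))"
      using u by (auto simp: n0_def)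
    have "(\<integral>y. g (n0 + n) y \<partial>\<nu>) \<le> (\<integral>y. (1 - e) * real_of_ereal (?\<phi> y) \<partial>\<nu>)"
    proof (rule integral_mono_AE)
      show "AE y in \<nu>. g (n0 + n) y \<le> (1 - e) * real_of_ereal (?\<phi> y)"
        using convex_L1_real(1)[OF L1]
      proof eventually_elim
        case (elim y)
        then show ?case unfolding g_def using e by (intro mult_left_mono Q_cbar_trunc_le) auto
      qed
    qed (use conv_classD[OF g] convex_L1_real(2)[OF L1] in auto)
    moreover have "(\<integral>x. v n x \<partial>\<mu>) \<le> (\<integral>x. u (n0 + n) x \<partial>\<mu>)"
      by (rule integral_mono[OF int_v int_u]) (simp add: v_def)
    ultimately have "ereal ((\<integral>x. v n x \<partial>\<mu>) - (1 - e) * (\<integral>y. real_of_ereal (?\<phi> y) \<partial>\<nu>))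
        \<le> B (\<lambda>y. ereal (g (n0 + n) y))"
      by (simp add: backward_eq[OF conv_class_convex_L1[OF g] un])
    also have "\<dots> \<le> D" unfolding backward_dual_def using g by (rule SUP_upper)
    finally show ?thesis .
  qed
  obtain d where d: "D = ereal d" using backward_dual_real by blast
  have "(\<integral>x. (1 - e) * f x \<partial>\<mu>) - (1 - e) * (\<integral>y. real_of_ereal (?\<phi> y) \<partial>\<nu>) \<le> d"
    by (rule LIMSEQ_le_const2[OF lim]) (use le in \<open>simp add: d\<close>)
  then show ?thesis by (simp add: d right_diff_distrib)
qed

lemma forward_le_backward_dual:
  assumes f: "f \<in> \<A>"
  shows "F (\<lambda>x. ereal (f x)) \<le> D"
  using f
proof (cases rule: forward_cases)
  case 2
  obtain d where d: "D = ereal d" using backward_dual_real by blast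
  have "(\<integral>x. f x \<partial>\<mu>) - (\<integral>y. real_of_ereal (Q_cbar (cost h) (\<lambda>x. ereal (f x)) y) \<partial>\<nu>) \<le> d"
  proof (rule field_le_mult_one_interval)
    fix z :: real assume "0 < z" "z < 1"
    with forward_scaled_le_backward_dual[OF f 2, of "1 - z"]
    show "z * ((\<integral>x. f x \<partial>\<mu>) - (\<integral>y. real_of_ereal (Q_cbar (cost h) (\<lambda>x. ereal (f x)) y) \<partial>\<nu>)) \<le> d"
      by (simp add: d)
  qed
  then show ?thesis by (simp add: forward_eq[OF f 2] d)
qed simp

section \<open>Attainment of both duals\<close>

text \<open>Only the transforms \<open>w n\<close> are bounded from both sides and can be made to
  converge. The \<open>g n\<close> need not converge, but along the subsequence their limit inferior
  dominates \<open>Q_cbar\<close> of the limit, and Fatou's lemma transfers their integral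
  bounds.\<close>

lemma forward_maximizer:
  obtains \<Psi> where "\<Psi> \<in> \<A>" "Q_cbar (cost h) (\<lambda>x. ereal (\<Psi> x)) \<in> convex_L1 \<nu>"
    "D \<le> F (\<lambda>x. ereal (\<Psi> x))"
proof -
  obtain d where d: "D = ereal d" "0 \<le> d" using backward_dual_real .
  have "\<exists>w g. w \<in> \<A> \<and> g \<in> \<A> \<and> (\<forall>x y. w x \<le> g y + h (x - y)) \<and> (\<forall>x. w x \<le> h (x - m)) \<and>
      0 \<le> (\<integral>y. g y \<partial>\<nu>) \<and> d - 1 / real (Suc n) < (\<integral>x. w x \<partial>\<mu>) - (\<integral>y. g y \<partial>\<nu>)" for n
  proof -
    have "ereal (d - 1 / real (Suc n)) < D" by (simp add: d)
    then obtain f where f: "f \<in> \<A>" and lt: "ereal (d - 1 / real (Suc n)) < B (\<lambda>x. ereal (f x))"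
      unfolding backward_dual_def less_SUP_iff by blast
    then have "B (\<lambda>x. ereal (f x)) \<noteq> -\<infinity>" by auto
    from backward_normalized[OF f this] show ?thesis
      using lt by (metis less_ereal.simps(1))
  qed
  then obtain w g where w: "\<And>n. w n \<in> \<A>" and g: "\<And>n. g n \<in> \<A>"
    and wg: "\<And>n x y. w n x \<le> g n y + h (x - y)" and wh: "\<And>n x. w n x \<le> h (x - m)"
    and g0: "\<And>n. 0 \<le> (\<integral>y. g n y \<partial>\<nu>)"
    and gap: "\<And>n. d - 1 / real (Suc n) < (\<integral>x. w n x \<partial>\<mu>) - (\<integral>y. g n y \<partial>\<nu>)"
    by metis
  \<comment> \<open>The constant of \<open>exists_small_gap\<close> when \<open>b\<close> is the
    integral of the cost.\<close>
  let ?K = "2 * (\<integral>x. h (x - m) \<partial>\<mu>) + 2"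
  obtain \<kappa> \<alpha> where \<kappa>: "0 < \<kappa>" "0 < \<alpha>" and lower:
    "\<And>\<psi> x0 x. convex_on UNIV \<psi> \<Longrightarrow> (\<And>x. \<psi> x \<le> h (x - m)) \<Longrightarrow> 2 * h (x0 - m) - \<psi> x0 \<le> ?K \<Longrightarrow>
       - \<kappa> * norm x - \<alpha> \<le> \<psi> x"
    using uniform_linear_lower_bound[of m ?K] by blast
  have w_lower: "- \<kappa> * norm x - \<alpha> \<le> w n x" for n x
  proof -
    have "1 / real (Suc n) \<le> 1" by simp
    then have "-1 \<le> (\<integral>x. w n x \<partial>\<mu>)"
      using gap[of n] g0[of n] d(2) by linarith
    from exists_small_gap[OF w this order_refl] obtain x0
      where "2 * h (x0 - m) - w n x0 \<le> ?K" by blast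
    then show ?thesis by (rule lower[OF conv_classD(1)[OF w] wh])
  qed
  \<comment> \<open>One envelope for two purposes: selecting the subsequence and dominating it under
    \<mu>.\<close>
  define b where "b x = \<kappa> * norm x + \<alpha> + h (x - m)" for x
  have b: "b \<in> C_bp p"
    unfolding b_def by (intro C_bp_add C_bp_cmult C_bp_norm C_bp_const cost_C_bp p)
  have wb: "\<bar>w n x\<bar> \<le> b x" for n x
  proof -
    have "0 \<le> \<kappa> * norm x" using \<kappa> by simp
    then show ?thesis
      using w_lower[of x n] wh[of n x] h_nonneg[of "x - m"] \<kappa> unfolding b_def by (intro abs_leI) linarith+
  qed
  obtain k \<Psi> where k: "strict_mono (k :: nat \<Rightarrow> nat)" and \<Psi>: "convex_on UNIV \<Psi>"
    and lim: "\<And>x. (\<lambda>n. w (k n) x) \<longlonglongrightarrow> \<Psi> x"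
    using convex_sequence_convergent_subsequence[of w b] conv_classD(1)[OF w] wb b
    by (auto simp: C_bp_iff)
  have "\<Psi> x \<le> h (x - m)" for x
    by (rule LIMSEQ_le_const2[OF lim]) (use wh in auto)
  then have \<Psi>_class: "\<Psi> \<in> \<A>"
    using convex_le_C_bp[OF p \<Psi> cost_C_bp] \<Psi> by (auto simp: convex_class_def)
  have lim_int: "(\<lambda>n. \<integral>x. w (k n) x \<partial>\<mu>) \<longlonglongrightarrow> (\<integral>x. \<Psi> x \<partial>\<mu>)"
  proof (rule integral_dominated_convergence)
    show "integrable \<mu> b" by (rule C_bp_integrable[OF \<mu> b])
    show "AE x in \<mu>. (\<lambda>n. w (k n) x) \<longlonglongrightarrow> \<Psi> x" using lim by simp
    show "AE x in \<mu>. norm (w (k n) x) \<le> b x" for n using wb by simp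
  qed (use conv_classD(3)[OF w] conv_classD(3)[OF \<Psi>_class] in auto)
  \<comment> \<open>Taking \<open>x = y\<close> in \<open>wg\<close> gives a minorant common to all
    \<open>g n\<close>; subtracting it makes Fatou's lemma applicable.\<close>
  define l where "l y = - \<kappa> * norm y - \<alpha> - h 0" for y :: 'a
  have "l \<in> C_bp p"
    unfolding l_def by (intro C_bp_diff C_bp_cmult C_bp_norm C_bp_const p)
  then have l: "integrable \<nu> l" by (rule C_bp_integrable[OF \<nu>])
  have lg: "l y \<le> g n y" for n y
    using wg[of n y y] w_lower[of y n] by (simp add: l_def)
  let ?\<phi> = "Q_cbar (cost h) (\<lambda>x. ereal (\<Psi> x))"
  have l\<phi>: "ereal (l y) \<le> ?\<phi> y" for y
  proof -
    have "- \<kappa> * norm y - \<alpha> \<le> \<Psi> y"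
      by (rule LIMSEQ_le_const[OF lim]) (use w_lower in auto)
    then have "ereal (l y) \<le> ereal (\<Psi> y - h 0)" by (simp add: l_def)
    then show ?thesis using Q_cbar_lower by (rule order_trans)
  qed
  \<comment> \<open>For fixed \<open>x\<close> the inequality \<open>wg\<close> passes to the limit
    inferior; only afterwards is the supremum over \<open>x\<close> taken.\<close>
  have fatou: "e2ennreal (?\<phi> y - ereal (l y)) \<le> liminf (\<lambda>n. ennreal (g (k n) y - l y))" (is "_ \<le> ?N y") for y
  proof -
    have "?\<phi> y \<le> enn2ereal (?N y) + ereal (l y)"
      unfolding Q_cbar_def
    proof (rule SUP_least)
      fix x
      have "(\<lambda>n. ennreal (w (k n) x - h (x - y) - l y)) \<longlonglongrightarrow> ennreal (\<Psi> x - h (x - y) - l y)"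
        by (intro tendsto_ennrealI tendsto_diff lim tendsto_const)
      then have "ennreal (\<Psi> x - h (x - y) - l y) = liminf (\<lambda>n. ennreal (w (k n) x - h (x - y) - l y))"
        by (intro lim_imp_Liminf[symmetric]) auto
      also have "\<dots> \<le> ?N y"
        using wg by (intro Liminf_mono always_eventually allI ennreal_leI) (simp add: algebra_simps)
      finally have "enn2ereal (ennreal (\<Psi> x - h (x - y) - l y)) \<le> enn2ereal (?N y)"
        by (simp add: less_eq_ennreal.rep_eq)
      then have "ereal (\<Psi> x - h (x - y) - l y) \<le> enn2ereal (?N y)"
        by (cases "0 \<le> \<Psi> x - h (x - y) - l y")
           (auto simp: enn2ereal_ennreal intro: order_trans[OF _ enn2ereal_nonneg])
      then show "ereal (\<Psi> x) - ereal (cost h x y) \<le> enn2ereal (?N y) + ereal (l y)"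
        by (cases "enn2ereal (?N y)") (auto simp: cost_def)
    qed
    then have "?\<phi> y - ereal (l y) \<le> enn2ereal (?N y)"
      by (cases "?\<phi> y"; cases "enn2ereal (?N y)") auto
    then have "e2ennreal (?\<phi> y - ereal (l y)) \<le> e2ennreal (enn2ereal (?N y))"
      by (rule e2ennreal_mono)
    then show ?thesis by simp
  qed
  have int_g: "integrable \<nu> (g n)" for n by (rule conv_classD[OF g])
  let ?r = "\<lambda>n. (\<integral>x. w (k n) x \<partial>\<mu>) - d + 1 / real (Suc (k n)) - (\<integral>y. l y \<partial>\<nu>)"
  let ?c = "(\<integral>x. \<Psi> x \<partial>\<mu>) - d - (\<integral>y. l y \<partial>\<nu>)"
  have "(\<lambda>n. 1 / real (Suc (k n))) \<longlonglongrightarrow> 0"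
    using LIMSEQ_subseq_LIMSEQ[OF LIMSEQ_inverse_real_of_nat k] by (simp add: o_def inverse_eq_divide)
  then have "?r \<longlonglongrightarrow> (\<integral>x. \<Psi> x \<partial>\<mu>) - d + 0 - (\<integral>y. l y \<partial>\<nu>)"
    by (intro tendsto_intros lim_int)
  then have lim_r: "?r \<longlonglongrightarrow> ?c" by simp
  have gr: "(\<integral>y. g (k n) y - l y \<partial>\<nu>) \<le> ?r n" for n
    using gap[of "k n"] int_g l by simp
  have "(\<integral>\<^sup>+y. e2ennreal (?\<phi> y - ereal (l y)) \<partial>\<nu>) \<le> (\<integral>\<^sup>+y. ?N y \<partial>\<nu>)"
    by (intro nn_integral_mono fatou)
  also have "\<dots> \<le> liminf (\<lambda>n. \<integral>\<^sup>+y. ennreal (g (k n) y - l y) \<partial>\<nu>)"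
    using int_g l by (intro nn_integral_liminf) auto
  also have "\<dots> \<le> liminf (\<lambda>n. ennreal (?r n))"
  proof (intro Liminf_mono always_eventually allI)
    fix n
    have "(\<integral>\<^sup>+y. ennreal (g (k n) y - l y) \<partial>\<nu>) = ennreal (\<integral>y. g (k n) y - l y \<partial>\<nu>)"
      using int_g l lg by (intro nn_integral_eq_integral) auto
    with gr[of n] show "(\<integral>\<^sup>+y. ennreal (g (k n) y - l y) \<partial>\<nu>) \<le> ennreal (?r n)"
      by (simp add: ennreal_leI)
  qed
  also have "\<dots> = ennreal ?c"
    by (intro lim_imp_Liminf tendsto_ennrealI lim_r) auto
  finally have le: "(\<integral>\<^sup>+y. e2ennreal (?\<phi> y - ereal (l y)) \<partial>\<nu>) \<le> ennreal ?c" .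
  \<comment> \<open>\<open>ennreal\<close> sends negative numbers to 0, so the bound by
    \<open>ennreal ?c\<close> carries over to real integrals only once \<open>?c\<close> is known to
    be nonnegative.\<close>
  have "0 \<le> ?r n" for n
    using lg by (intro order_trans[OF Bochner_Integration.integral_nonneg gr]) simp
  then have c: "0 \<le> ?c"
    by (intro LIMSEQ_le_const[OF lim_r]) auto
  note L1 = convex_L1I_nn_integral_le[OF Q_cbar_ext_convex[OF \<Psi>] Q_cbar_measurable[OF \<Psi>_class] l l\<phi> le c]
  show thesis
    by (rule that[OF \<Psi>_class L1(1)]) (use L1(2) in \<open>simp add: forward_eq[OF \<Psi>_class L1(1)] d\<close>)
qed

lemma forward_dual_eq: "forward_dual p (cost h) \<mu> \<nu> = D"
proof (rule antisym)
  show "forward_dual p (cost h) \<mu> \<nu> \<le> D"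
    unfolding forward_dual_def by (intro SUP_least forward_le_backward_dual)
  obtain \<Psi> where "\<Psi> \<in> \<A>" "D \<le> F (\<lambda>x. ereal (\<Psi> x))" using forward_maximizer by blast
  then show "D \<le> forward_dual p (cost h) \<mu> \<nu>"
    unfolding forward_dual_def by (intro SUP_upper2)
qed

lemma forward_optimizerI: "\<psi> \<in> \<A> \<Longrightarrow> D \<le> F (\<lambda>x. ereal (\<psi> x)) \<Longrightarrow> forward_optimizer p (cost h) \<mu> \<nu> \<psi>"
  using forward_le_backward_dual[of \<psi>] by (auto simp: forward_optimizer_def forward_dual_eq)

lemma optimizers_exist:
  shows "\<exists>\<phi>. backward_optimizer p (cost h) \<mu> \<nu> \<phi>" and "\<exists>\<psi>. forward_optimizer p (cost h) \<mu> \<nu> \<psi>"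
proof -
  obtain \<Psi> where \<Psi>: "\<Psi> \<in> \<A>" "D \<le> F (\<lambda>x. ereal (\<Psi> x))"
    and L1: "Q_cbar (cost h) (\<lambda>x. ereal (\<Psi> x)) \<in> convex_L1 \<nu>" (is "?\<phi> \<in> _")
    by (rule forward_maximizer)
  from \<Psi> show "\<exists>\<psi>. forward_optimizer p (cost h) \<mu> \<nu> \<psi>"
    using forward_optimizerI by blast
  obtain u where u: "u \<in> \<A>" "Q_c (cost h) ?\<phi> = (\<lambda>x. ereal (u x))"
    using forward_le_backward(2)[OF \<Psi>(1) L1] by blast
  \<comment> \<open>\<open>?\<phi>\<close> may lie outside \<open>C_bp p\<close>, where the supremum
    defining \<open>D\<close> says nothing; its value is bounded through the forward functional of
    its transform.\<close>
  have "B ?\<phi> \<le> D"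
    using backward_le_forward[OF L1 u] forward_le_backward_dual[OF u(1)] by (rule order_trans)
  moreover have "D \<le> B ?\<phi>"
    using \<Psi>(2) forward_le_backward(1)[OF \<Psi>(1) L1] by (rule order_trans)
  ultimately show "\<exists>\<phi>. backward_optimizer p (cost h) \<mu> \<nu> \<phi>"
    using L1 by (auto simp: backward_optimizer_def)
qed

text \<open>The last clause exports the gap inequality in place of the linear bound, because
  \<kappa> and \<alpha> have to be fixed before the measures are known.\<close>

lemma forward_optimizer_Q_c:
  assumes \<phi>: "backward_optimizer p (cost h) \<mu> \<nu> \<phi>" "\<phi> m = 0"
  obtains \<psi> where "forward_optimizer p (cost h) \<mu> \<nu> \<psi>" "\<And>x. ereal (\<psi> x) = Q_c (cost h) \<phi> x"
    "convex_on UNIV \<psi>" "\<And>x. \<psi> x \<le> h (x - m)"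
    "\<And>b. dual_bound (cost h) \<mu> \<nu> b \<Longrightarrow> \<exists>x0. 2 * h (x0 - m) - \<psi> x0 \<le> 2 * b + 2"
proof -
  have L1: "\<phi> \<in> convex_L1 \<nu>" and opt: "B \<phi> = D"
    using \<phi>(1) by (auto simp: backward_optimizer_def)
  have "B \<phi> \<noteq> -\<infinity>" using backward_dual_nonneg opt by auto
  then obtain u where u: "u \<in> \<A>" "Q_c (cost h) \<phi> = (\<lambda>x. ereal (u x))"
    using backward_cases[OF L1] by metis
  show thesis
  proof (rule that)
    show "forward_optimizer p (cost h) \<mu> \<nu> u"
      using backward_le_forward[OF L1 u] by (intro forward_optimizerI u) (simp add: opt)
    show "ereal (u x) = Q_c (cost h) \<phi> x" for x by (simp add: u)
    show "convex_on UNIV u" by (rule conv_classD[OF u(1)])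
    show "u x \<le> h (x - m)" for x
      using Q_c_le[of "cost h" \<phi> x m] \<phi>(2) by (simp add: u cost_def)
    have "0 \<le> (\<integral>y. real_of_ereal (\<phi> y) \<partial>\<nu>)"
      using jensen_convex_L1[OF p \<nu> L1] \<phi>(2) by simp
    moreover have "0 \<le> B \<phi>" using backward_dual_nonneg opt by simp
    ultimately have "0 \<le> (\<integral>x. u x \<partial>\<mu>)"
      by (simp add: backward_eq[OF L1 u])
    then show "\<exists>x0. 2 * h (x0 - m) - u x0 \<le> 2 * b + 2" if "dual_bound (cost h) \<mu> \<nu> b" for b
      using that by (intro exists_small_gap u) (auto simp: dual_bound_def cost_def)
  qed
qed

end

theorem theorem3:
  fixes h :: "'a::euclidean_space \<Rightarrow> real"
  shows
    "(\<forall>p \<mu> \<nu>. 1 \<le> p \<longrightarrow> admissible p h \<longrightarrow> \<mu> \<in> P_space p \<longrightarrow> \<nu> \<in> P_space p \<longrightarrow>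
        (\<exists>\<phi>. backward_optimizer p (cost h) \<mu> \<nu> \<phi>) \<and>
        (\<exists>\<psi>. forward_optimizer p (cost h) \<mu> \<nu> \<psi>)) \<and>
     (\<forall>m B. \<exists>\<kappa>>0. \<exists>\<alpha>>0. \<forall>p \<mu> \<nu> \<phi>.
        1 \<le> p \<longrightarrow> admissible p h \<longrightarrow> \<mu> \<in> P_space p \<longrightarrow> \<nu> \<in> P_space p \<longrightarrow>
        mean \<nu> = m \<longrightarrow> dual_bound (cost h) \<mu> \<nu> B \<longrightarrow>
        backward_optimizer p (cost h) \<mu> \<nu> \<phi> \<longrightarrow> \<phi> m = 0 \<longrightarrow>
        (\<exists>\<psi>. forward_optimizer p (cost h) \<mu> \<nu> \<psi> \<and>
             (\<forall>x. ereal (\<psi> x) = Q_c (cost h) \<phi> x) \<and>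
             (\<forall>x. - \<kappa> * norm x - \<alpha> \<le> \<psi> x \<and> \<psi> x \<le> h (x - m))))"
proof (rule conjI)
  have dual_pairI: "dual_pair p h \<mu> \<nu>"
    if "1 \<le> p" "admissible p h" "\<mu> \<in> P_space p" "\<nu> \<in> P_space p" for p and \<mu> \<nu> :: "'a measure"
    using that by (auto simp: dual_pair_def dual_pair_axioms_def admissible_cost_def)
  show "\<forall>p \<mu> \<nu>. 1 \<le> p \<longrightarrow> admissible p h \<longrightarrow> \<mu> \<in> P_space p \<longrightarrow> \<nu> \<in> P_space p \<longrightarrow>
        (\<exists>\<phi>. backward_optimizer p (cost h) \<mu> \<nu> \<phi>) \<and> (\<exists>\<psi>. forward_optimizer p (cost h) \<mu> \<nu> \<psi>)"
    using dual_pair.optimizers_exist[OF dual_pairI] by blast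
  show "\<forall>m B. \<exists>\<kappa>>0. \<exists>\<alpha>>0. \<forall>p \<mu> \<nu> \<phi>.
        1 \<le> p \<longrightarrow> admissible p h \<longrightarrow> \<mu> \<in> P_space p \<longrightarrow> \<nu> \<in> P_space p \<longrightarrow>
        mean \<nu> = m \<longrightarrow> dual_bound (cost h) \<mu> \<nu> B \<longrightarrow>
        backward_optimizer p (cost h) \<mu> \<nu> \<phi> \<longrightarrow> \<phi> m = 0 \<longrightarrow>
        (\<exists>\<psi>. forward_optimizer p (cost h) \<mu> \<nu> \<psi> \<and>
             (\<forall>x. ereal (\<psi> x) = Q_c (cost h) \<phi> x) \<and>
             (\<forall>x. - \<kappa> * norm x - \<alpha> \<le> \<psi> x \<and> \<psi> x \<le> h (x - m)))"
  proof (intro allI)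
    fix m :: 'a and B :: real
    show "\<exists>\<kappa>>0. \<exists>\<alpha>>0. \<forall>p \<mu> \<nu> \<phi>.
        1 \<le> p \<longrightarrow> admissible p h \<longrightarrow> \<mu> \<in> P_space p \<longrightarrow> \<nu> \<in> P_space p \<longrightarrow>
        mean \<nu> = m \<longrightarrow> dual_bound (cost h) \<mu> \<nu> B \<longrightarrow>
        backward_optimizer p (cost h) \<mu> \<nu> \<phi> \<longrightarrow> \<phi> m = 0 \<longrightarrow>
        (\<exists>\<psi>. forward_optimizer p (cost h) \<mu> \<nu> \<psi> \<and>
             (\<forall>x. ereal (\<psi> x) = Q_c (cost h) \<phi> x) \<and>
             (\<forall>x. - \<kappa> * norm x - \<alpha> \<le> \<psi> x \<and> \<psi> x \<le> h (x - m)))"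
    \<comment> \<open>The constants are chosen before any \<open>p\<close> is given. If no exponent
      is admissible, the claim is vacuous and 1 will do; otherwise some admissible \<open>q\<close>
      yields constants whose property does not mention the exponent, so they serve every
      \<open>p\<close>.\<close>
    proof (cases "\<exists>q\<ge>1. admissible q h")
      case False
      then show ?thesis by (intro exI[of _ 1] conjI) auto
    next
      case True
      then obtain q where q: "1 \<le> q" "admissible q h" by blast
      then interpret admissible_cost q h by unfold_locales
      obtain \<kappa> \<alpha> where \<kappa>: "0 < \<kappa>" "0 < \<alpha>" and lower:
        "\<And>\<psi> x0 x. convex_on UNIV \<psi> \<Longrightarrow> (\<And>x. \<psi> x \<le> h (x - m)) \<Longrightarrow>
          2 * h (x0 - m) - \<psi> x0 \<le> 2 * B + 2 \<Longrightarrow> - \<kappa> * norm x - \<alpha> \<le> \<psi> x"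
        using uniform_linear_lower_bound[of m "2 * B + 2"] by blast
      show ?thesis
      proof (rule exI[of _ \<kappa>], rule conjI[OF \<kappa>(1)], rule exI[of _ \<alpha>], rule conjI[OF \<kappa>(2)], intro allI impI)
        fix p \<mu> \<nu> \<phi>
        assume "1 \<le> p" "admissible p h" "\<mu> \<in> P_space p" "\<nu> \<in> P_space p"
          and m: "mean \<nu> = m" and bound: "dual_bound (cost h) \<mu> \<nu> B"
          and opt: "backward_optimizer p (cost h) \<mu> \<nu> \<phi>" "\<phi> m = 0"
        then interpret dp: dual_pair p h \<mu> \<nu> by (intro dual_pairI)
        obtain \<psi> where \<psi>: "forward_optimizer p (cost h) \<mu> \<nu> \<psi>"
          "\<And>x. ereal (\<psi> x) = Q_c (cost h) \<phi> x" "convex_on UNIV \<psi>" "\<And>x. \<psi> x \<le> h (x - m)"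
          and gap: "\<exists>x0. 2 * h (x0 - m) - \<psi> x0 \<le> 2 * B + 2"
          using dp.forward_optimizer_Q_c[OF opt(1)] opt(2) bound unfolding m by metis
        then show "\<exists>\<psi>. forward_optimizer p (cost h) \<mu> \<nu> \<psi> \<and>
             (\<forall>x. ereal (\<psi> x) = Q_c (cost h) \<phi> x) \<and>
             (\<forall>x. - \<kappa> * norm x - \<alpha> \<le> \<psi> x \<and> \<psi> x \<le> h (x - m))"
          using lower[OF \<psi>(3,4)] by blast
      qed
    qed
  qed
qed

end
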